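(* Let $K$ be a field, let $k\ge 2$ be an integer, and let $a,d\in\mathbb{N}^2$ be linearly independent over $\mathbb{Q}$ such that $\{a,a+d,\ldots,a+kd\}$ is a minimal generating set of $S_{a,d,k}=\langle a,a+d,\ldots,a+kd\rangle$. Then the semigroup ring $K[S_{a,d,k}]$ is Cohen-Macaulay.
   Context: $\mathbb{N}$ denotes the set of non-negative integers. For $a_1,\ldots,a_n\in\mathbb{N}^r$, $\langle a_1,\ldots,a_n\rangle=\{\sum_i\lambda_i a_i\mid \lambda_i\in\mathbb{N}\}$ is the affine semigroup they generate. For an affine semigroup $S\subseteq\mathbb{N}^r$, the semigroup ring $K[S]=\bigoplus_{s\in S}K\mathbf{t}^s$ is the $K$-subalgebra of $K[t_1,\ldots,t_r]$ spanned by the monomials $\mathbf{t}^s=t_1^{s_1}\cdots t_r^{s_r}$, $s\in S$. *)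

theory Defs
  imports
    "HOL-Algebra.Ring_Divisibility"
    "HOL-Library.Poly_Mapping"
    "HOL-Library.Product_Plus"
    "HOL-Library.Extended_Nat"
begin

section \<open>Localization\<close>

text \<open>The fraction \<open>r/s\<close> in \<open>T\<^sup>-\<^sup>1R\<close>, as an equivalence class: \<open>r/s = r'/s'\<close> iff
  \<open>u(rs' - r's) = 0\<close> for some \<open>u \<in> T\<close>. The factor \<open>u\<close> is needed because \<open>R\<close> may have
  zero divisors.\<close>

definition loc_frac :: "('a, 'b) ring_scheme \<Rightarrow> 'a set \<Rightarrow> 'a \<Rightarrow> 'a \<Rightarrow> ('a \<times> 'a) set" where
  "loc_frac R T r s = {(r', s'). r' \<in> carrier R \<and> s' \<in> T \<and>
     (\<exists>u\<in>T. u \<otimes>\<^bsub>R\<^esub> (r \<otimes>\<^bsub>R\<^esub> s') = u \<otimes>\<^bsub>R\<^esub> (r' \<otimes>\<^bsub>R\<^esub> s))}"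

text \<open>The operations are unions over all choices of representatives; the lemmas
  \<open>localization_mult\<close> and \<open>localization_add\<close> below show that the choice does not matter.\<close>

definition localization :: "('a, 'b) ring_scheme \<Rightarrow> 'a set \<Rightarrow> ('a \<times> 'a) set ring" where
  "localization R T =
     \<lparr>carrier = {loc_frac R T r s | r s. r \<in> carrier R \<and> s \<in> T},
      mult = (\<lambda>X Y. \<Union>(r, s)\<in>X. \<Union>(r', s')\<in>Y. loc_frac R T (r \<otimes>\<^bsub>R\<^esub> r') (s \<otimes>\<^bsub>R\<^esub> s')),
      one = loc_frac R T \<one>\<^bsub>R\<^esub> \<one>\<^bsub>R\<^esub>,
      zero = loc_frac R T \<zero>\<^bsub>R\<^esub> \<one>\<^bsub>R\<^esub>,
      add = (\<lambda>X Y. \<Union>(r, s)\<in>X. \<Union>(r', s')\<in>Y.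
               loc_frac R T ((r \<otimes>\<^bsub>R\<^esub> s') \<oplus>\<^bsub>R\<^esub> (r' \<otimes>\<^bsub>R\<^esub> s)) (s \<otimes>\<^bsub>R\<^esub> s'))\<rparr>"

definition local_at :: "('a, 'b) ring_scheme \<Rightarrow> 'a set \<Rightarrow> ('a \<times> 'a) set ring" where
  "local_at R P = localization R (carrier R - P)"

locale mult_closed = cring +
  fixes T
  assumes T_subset: "T \<subseteq> carrier R"
    and T_one: "\<one> \<in> T"
    and T_mult: "s \<in> T \<Longrightarrow> s' \<in> T \<Longrightarrow> s \<otimes> s' \<in> T"
begin

lemma T_carrier [simp]: "s \<in> T \<Longrightarrow> s \<in> carrier R"
  using T_subset by blast

lemma loc_frac_trans:
  assumes "r \<in> carrier R" "s \<in> T" "r' \<in> carrier R" "s' \<in> T" "r'' \<in> carrier R" "s'' \<in> T"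
    and "u \<in> T" "u \<otimes> (r \<otimes> s') = u \<otimes> (r' \<otimes> s)"
    and "v \<in> T" "v \<otimes> (r' \<otimes> s'') = v \<otimes> (r'' \<otimes> s')"
  shows "\<exists>w\<in>T. w \<otimes> (r \<otimes> s'') = w \<otimes> (r'' \<otimes> s)"
proof
  show "u \<otimes> v \<otimes> s' \<in> T" using assms T_mult by simp
  note c = assms(1-7,9)
  have "u \<otimes> v \<otimes> s' \<otimes> (r \<otimes> s'') = (v \<otimes> s'') \<otimes> (u \<otimes> (r \<otimes> s'))"
    using c by (simp add: m_ac)
  also have "\<dots> = (u \<otimes> s) \<otimes> (v \<otimes> (r' \<otimes> s''))"
    unfolding assms(8) using c by (simp add: m_ac)
  also have "\<dots> = u \<otimes> v \<otimes> s' \<otimes> (r'' \<otimes> s)"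
    unfolding assms(10) using c by (simp add: m_ac)
  finally show "u \<otimes> v \<otimes> s' \<otimes> (r \<otimes> s'') = u \<otimes> v \<otimes> s' \<otimes> (r'' \<otimes> s)" .
qed

lemma loc_frac_self: "r \<in> carrier R \<Longrightarrow> s \<in> T \<Longrightarrow> (r, s) \<in> loc_frac R T r s"
  using T_one by (auto simp: loc_frac_def)

lemma loc_frac_eq_iff:
  assumes "r \<in> carrier R" "s \<in> T" "r' \<in> carrier R" "s' \<in> T"
  shows "loc_frac R T r s = loc_frac R T r' s' \<longleftrightarrow> (\<exists>u\<in>T. u \<otimes> (r \<otimes> s') = u \<otimes> (r' \<otimes> s))"
proof
  assume "loc_frac R T r s = loc_frac R T r' s'"
  with loc_frac_self[OF assms(3,4)] have "(r', s') \<in> loc_frac R T r s" by simp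
  then show "\<exists>u\<in>T. u \<otimes> (r \<otimes> s') = u \<otimes> (r' \<otimes> s)" by (simp add: loc_frac_def)
next
  assume "\<exists>u\<in>T. u \<otimes> (r \<otimes> s') = u \<otimes> (r' \<otimes> s)"
  then obtain u where u: "u \<in> T" "u \<otimes> (r \<otimes> s') = u \<otimes> (r' \<otimes> s)" by blast
  show "loc_frac R T r s = loc_frac R T r' s'"
    unfolding loc_frac_def
    using loc_frac_trans[OF assms(3,4,1,2) _ _ u(1) u(2)[symmetric]]
      loc_frac_trans[OF assms _ _ u] by fast
qed

lemma loc_frac_eqI:
  assumes "r \<in> carrier R" "s \<in> T" "(x, y) \<in> loc_frac R T r s"
  shows "x \<in> carrier R" "y \<in> T" "loc_frac R T x y = loc_frac R T r s"
proof -
  show x: "x \<in> carrier R" and y: "y \<in> T" using assms(3) by (auto simp: loc_frac_def)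
  show "loc_frac R T x y = loc_frac R T r s"
    using assms(3) loc_frac_eq_iff[OF assms(1,2) x y] by (auto simp: loc_frac_def)
qed

lemma loc_frac_mult_cong:
  assumes c: "r \<in> carrier R" "s \<in> T" "r' \<in> carrier R" "s' \<in> T"
    "x \<in> carrier R" "y \<in> T" "x' \<in> carrier R" "y' \<in> T"
    and "loc_frac R T x y = loc_frac R T r s" "loc_frac R T x' y' = loc_frac R T r' s'"
  shows "loc_frac R T (x \<otimes> x') (y \<otimes> y') = loc_frac R T (r \<otimes> r') (s \<otimes> s')"
proof -
  obtain u where u: "u \<in> T" "u \<otimes> (x \<otimes> s) = u \<otimes> (r \<otimes> y)"
    using assms(9) loc_frac_eq_iff[OF c(5,6,1,2)] by blast
  obtain v where v: "v \<in> T" "v \<otimes> (x' \<otimes> s') = v \<otimes> (r' \<otimes> y')"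
    using assms(10) loc_frac_eq_iff[OF c(7,8,3,4)] by blast
  have "(u \<otimes> v) \<otimes> ((x \<otimes> x') \<otimes> (s \<otimes> s')) = (u \<otimes> (x \<otimes> s)) \<otimes> (v \<otimes> (x' \<otimes> s'))"
    using c u(1) v(1) by (simp add: m_ac)
  also have "\<dots> = (u \<otimes> v) \<otimes> ((r \<otimes> r') \<otimes> (y \<otimes> y'))"
    unfolding u(2) v(2) using c u(1) v(1) by (simp add: m_ac)
  finally show ?thesis
    using c u(1) v(1) T_mult by (subst loc_frac_eq_iff) blast+
qed

lemma loc_frac_add_cong:
  assumes c: "r \<in> carrier R" "s \<in> T" "r' \<in> carrier R" "s' \<in> T"
    "x \<in> carrier R" "y \<in> T" "x' \<in> carrier R" "y' \<in> T"
    and "loc_frac R T x y = loc_frac R T r s" "loc_frac R T x' y' = loc_frac R T r' s'"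
  shows "loc_frac R T (x \<otimes> y' \<oplus> x' \<otimes> y) (y \<otimes> y') = loc_frac R T (r \<otimes> s' \<oplus> r' \<otimes> s) (s \<otimes> s')"
proof -
  obtain u where u: "u \<in> T" "u \<otimes> (x \<otimes> s) = u \<otimes> (r \<otimes> y)"
    using assms(9) loc_frac_eq_iff[OF c(5,6,1,2)] by blast
  obtain v where v: "v \<in> T" "v \<otimes> (x' \<otimes> s') = v \<otimes> (r' \<otimes> y')"
    using assms(10) loc_frac_eq_iff[OF c(7,8,3,4)] by blast
  have "(u \<otimes> v) \<otimes> ((x \<otimes> y' \<oplus> x' \<otimes> y) \<otimes> (s \<otimes> s')) =
      (v \<otimes> s' \<otimes> y') \<otimes> (u \<otimes> (x \<otimes> s)) \<oplus> (u \<otimes> s \<otimes> y) \<otimes> (v \<otimes> (x' \<otimes> s'))"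
    using c u(1) v(1) by (simp add: r_distr l_distr m_ac)
  also have "\<dots> = (u \<otimes> v) \<otimes> ((r \<otimes> s' \<oplus> r' \<otimes> s) \<otimes> (y \<otimes> y'))"
    unfolding u(2) v(2) using c u(1) v(1) by (simp add: r_distr l_distr m_ac)
  finally show ?thesis
    using c u(1) v(1) T_mult by (subst loc_frac_eq_iff) (auto intro: bexI[of _ "u \<otimes> v"])
qed

lemma localization_mult:
  assumes c: "r \<in> carrier R" "s \<in> T" "r' \<in> carrier R" "s' \<in> T"
  shows "loc_frac R T r s \<otimes>\<^bsub>localization R T\<^esub> loc_frac R T r' s' = loc_frac R T (r \<otimes> r') (s \<otimes> s')"
proof -
  have "loc_frac R T (x \<otimes> x') (y \<otimes> y') = loc_frac R T (r \<otimes> r') (s \<otimes> s')"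
    if "(x, y) \<in> loc_frac R T r s" "(x', y') \<in> loc_frac R T r' s'" for x y x' y'
    using loc_frac_eqI[OF c(1,2) that(1)] loc_frac_eqI[OF c(3,4) that(2)]
    by (intro loc_frac_mult_cong[OF c])
  moreover have "loc_frac R T r s \<noteq> {}" "loc_frac R T r' s' \<noteq> {}"
    using loc_frac_self[OF c(1,2)] loc_frac_self[OF c(3,4)] by blast+
  ultimately show ?thesis
    unfolding localization_def ring.simps monoid.simps split_def
    by (intro SUP_eq_const) auto
qed

lemma localization_add:
  assumes c: "r \<in> carrier R" "s \<in> T" "r' \<in> carrier R" "s' \<in> T"
  shows "loc_frac R T r s \<oplus>\<^bsub>localization R T\<^esub> loc_frac R T r' s' =
    loc_frac R T (r \<otimes> s' \<oplus> r' \<otimes> s) (s \<otimes> s')"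
proof -
  have "loc_frac R T (x \<otimes> y' \<oplus> x' \<otimes> y) (y \<otimes> y') = loc_frac R T (r \<otimes> s' \<oplus> r' \<otimes> s) (s \<otimes> s')"
    if "(x, y) \<in> loc_frac R T r s" "(x', y') \<in> loc_frac R T r' s'" for x y x' y'
    using loc_frac_eqI[OF c(1,2) that(1)] loc_frac_eqI[OF c(3,4) that(2)]
    by (intro loc_frac_add_cong[OF c])
  moreover have "loc_frac R T r s \<noteq> {}" "loc_frac R T r' s' \<noteq> {}"
    using loc_frac_self[OF c(1,2)] loc_frac_self[OF c(3,4)] by blast+
  ultimately show ?thesis
    unfolding localization_def ring.simps monoid.simps split_def
    by (intro SUP_eq_const) auto
qed

lemma localization_cring: "cring (localization R T)"
proof -
  let ?L = "localization R T"
  have car: "X \<in> carrier ?L \<longleftrightarrow> (\<exists>r\<in>carrier R. \<exists>s\<in>T. X = loc_frac R T r s)" for X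
    by (auto simp: localization_def)
  have one: "\<one>\<^bsub>?L\<^esub> = loc_frac R T \<one> \<one>" and zero: "\<zero>\<^bsub>?L\<^esub> = loc_frac R T \<zero> \<one>"
    by (simp_all add: localization_def)
  have eqI: "loc_frac R T r s = loc_frac R T r' s'"
    if "r \<otimes> s' = r' \<otimes> s" "r \<in> carrier R" "s \<in> T" "r' \<in> carrier R" "s' \<in> T" for r s r' s'
    using that T_one by (subst loc_frac_eq_iff) auto
  show ?thesis
  proof (intro cringI abelian_groupI comm_monoidI)
    fix X assume "X \<in> carrier ?L"
    then obtain r s where rs: "r \<in> carrier R" "s \<in> T" "X = loc_frac R T r s" by (auto simp: car)
    have "loc_frac R T (\<ominus> r) s \<oplus>\<^bsub>?L\<^esub> X = \<zero>\<^bsub>?L\<^esub>"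
      using rs T_one T_mult
      by (simp add: localization_add zero) (intro eqI, auto simp flip: l_distr simp: l_neg)
    then show "\<exists>Y\<in>carrier ?L. Y \<oplus>\<^bsub>?L\<^esub> X = \<zero>\<^bsub>?L\<^esub>"
      using rs by (intro bexI[of _ "loc_frac R T (\<ominus> r) s"]) (auto simp: car)
  next
    fix X Y Z assume "X \<in> carrier ?L" "Y \<in> carrier ?L" "Z \<in> carrier ?L"
    then obtain r s r' s' r'' s'' where
      c: "r \<in> carrier R" "s \<in> T" "r' \<in> carrier R" "s' \<in> T" "r'' \<in> carrier R" "s'' \<in> T"
      and XYZ: "X = loc_frac R T r s" "Y = loc_frac R T r' s'" "Z = loc_frac R T r'' s''"
      by (auto simp: car)
    show "(X \<oplus>\<^bsub>?L\<^esub> Y) \<otimes>\<^bsub>?L\<^esub> Z = X \<otimes>\<^bsub>?L\<^esub> Z \<oplus>\<^bsub>?L\<^esub> Y \<otimes>\<^bsub>?L\<^esub> Z"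
      using c T_mult
      by (simp add: XYZ localization_mult localization_add)
        (rule eqI, auto simp: r_distr l_distr m_ac a_ac)
  qed (use T_one T_mult in \<open>auto simp: car one zero localization_mult localization_add
         r_distr l_distr m_ac a_ac intro!: eqI bexI\<close>)
qed

end

lemma (in primeideal) local_at_cring: "cring (local_at R I)"
proof -
  have "\<one> \<notin> I"
    using I_notcarr one_imp_carrier by blast
  then have "mult_closed R (carrier R - I)"
    using I_prime by unfold_locales auto
  then show ?thesis
    unfolding local_at_def by (rule mult_closed.localization_cring)
qed


section \<open>Cohen-Macaulay rings\<close>

definition krull_dim :: "('a, 'b) ring_scheme \<Rightarrow> enat" where
  "krull_dim R = Sup {enat n | n. \<exists>P :: nat \<Rightarrow> 'a set.
     (\<forall>i\<le>n. primeideal (P i) R) \<and> (\<forall>i<n. P i \<subset> P (Suc i))}"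

text \<open>The condition on \<open>xs ! i\<close> says that it is a nonzerodivisor on
  \<open>R / (xs ! 0, \<dots>, xs ! (i - 1))\<close>.\<close>

definition regular_sequence :: "('a, 'b) ring_scheme \<Rightarrow> 'a list \<Rightarrow> bool" where
  "regular_sequence R xs \<longleftrightarrow>
     set xs \<subseteq> carrier R \<and>
     (\<forall>i<length xs. \<forall>r\<in>carrier R.
        xs ! i \<otimes>\<^bsub>R\<^esub> r \<in> Idl\<^bsub>R\<^esub> (set (take i xs)) \<longrightarrow> r \<in> Idl\<^bsub>R\<^esub> (set (take i xs))) \<and>
     Idl\<^bsub>R\<^esub> (set xs) \<noteq> carrier R"

definition depth :: "('a, 'b) ring_scheme \<Rightarrow> 'a set \<Rightarrow> enat" where
  "depth R I = Sup {enat (length xs) | xs. regular_sequence R xs \<and> set xs \<subseteq> I}"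

text \<open>Noetherian local rings \<open>(R, m)\<close> with \<open>depth R = dim R\<close>, the depth being taken
  in the unique maximal ideal \<open>m\<close>.\<close>

definition cohen_macaulay_local :: "('a, 'b) ring_scheme \<Rightarrow> bool" where
  "cohen_macaulay_local R \<longleftrightarrow> cring R \<and> noetherian_ring R \<and>
     (\<exists>m. {I. maximalideal I R} = {m} \<and> depth R m = krull_dim R)"

definition cohen_macaulay :: "('a, 'b) ring_scheme \<Rightarrow> bool" where
  "cohen_macaulay R \<longleftrightarrow> cring R \<and> noetherian_ring R \<and>
     (\<forall>m. maximalideal m R \<longrightarrow> cohen_macaulay_local (local_at R m))"


section \<open>Affine semigroups in \<open>\<nat>\<^sup>2\<close> and their semigroup rings\<close>

definition nscale :: "nat \<Rightarrow> nat \<times> nat \<Rightarrow> nat \<times> nat" where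
  "nscale n v = (n * fst v, n * snd v)"

definition semigroup_gen :: "(nat \<times> nat) set \<Rightarrow> (nat \<times> nat) set" where
  "semigroup_gen A = {\<Sum>x\<in>A. nscale (l x) x | l. True}"

definition minimal_generating_set :: "(nat \<times> nat) set \<Rightarrow> (nat \<times> nat) set \<Rightarrow> bool" where
  "minimal_generating_set A S \<longleftrightarrow>
     finite A \<and> semigroup_gen A = S \<and> (\<forall>B. B \<subset> A \<longrightarrow> semigroup_gen B \<noteq> S)"

definition lin_indep_rat :: "nat \<times> nat \<Rightarrow> nat \<times> nat \<Rightarrow> bool" where
  "lin_indep_rat v w \<longleftrightarrow>
     (\<forall>x y :: rat. x * of_nat (fst v) + y * of_nat (fst w) = 0 \<and>
        x * of_nat (snd v) + y * of_nat (snd w) = 0 \<longrightarrow> x = 0 \<and> y = 0)"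

definition arith_gens :: "nat \<times> nat \<Rightarrow> nat \<times> nat \<Rightarrow> nat \<Rightarrow> (nat \<times> nat) set" where
  "arith_gens a d k = (\<lambda>i. a + nscale i d) ` {0..k}"

text \<open>\<open>K[t\<^sub>1, t\<^sub>2]\<close> is the type \<open>(nat \<times> nat) \<Rightarrow>\<^sub>0 'k\<close> of finitely supported functions from
  exponent vectors to coefficients, with convolution as multiplication;
  \<open>Poly_Mapping.single s 1\<close> is the monomial with exponent vector \<open>s\<close>. The semigroup ring
  is the span of the monomials with exponent in \<open>S\<close>, see \<open>semigroup_ring_span\<close>.\<close>

definition semigroup_ring ::
    "'k::field itself \<Rightarrow> (nat \<times> nat) set \<Rightarrow> ((nat \<times> nat) \<Rightarrow>\<^sub>0 'k) ring" where
  "semigroup_ring K S =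
     \<lparr>carrier = {p. Poly_Mapping.keys p \<subseteq> S}, mult = (*), one = 1, zero = 0, add = (+)\<rparr>"

lemma semigroup_ring_span:
  "carrier (semigroup_ring TYPE('k::field) S) =
     {\<Sum>s\<in>A. Poly_Mapping.single s (c s) | A c. finite A \<and> A \<subseteq> S}"
proof (intro equalityI subsetI)
  fix p assume "p \<in> carrier (semigroup_ring TYPE('k) S)"
  moreover have "p = (\<Sum>s\<in>Poly_Mapping.keys p. Poly_Mapping.single s (Poly_Mapping.lookup p s))"
    by (rule poly_mapping_eqI)
      (simp add: lookup_sum lookup_single when_def in_keys_iff)
  ultimately show "p \<in> {\<Sum>s\<in>A. Poly_Mapping.single s (c s) | A c. finite A \<and> A \<subseteq> S}"
    unfolding semigroup_ring_def by fastforce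
next
  fix p :: "(nat \<times> nat) \<Rightarrow>\<^sub>0 'k"
  assume "p \<in> {\<Sum>s\<in>A. Poly_Mapping.single s (c s) | A c. finite A \<and> A \<subseteq> S}"
  then obtain A and c :: "nat \<times> nat \<Rightarrow> 'k"
    where p: "p = (\<Sum>s\<in>A. Poly_Mapping.single s (c s))" "A \<subseteq> S" by auto
  have "Poly_Mapping.keys p \<subseteq> A"
    unfolding p(1) by (rule order.trans[OF keys_sum]) (auto split: if_splits)
  with p(2) show "p \<in> carrier (semigroup_ring TYPE('k) S)"
    by (auto simp: semigroup_ring_def)
qed

lemma semigroup_ring_cring:
  "cring (semigroup_ring TYPE('k::field) (semigroup_gen A))"
proof -
  let ?S = "semigroup_gen A" and ?R = "semigroup_ring TYPE('k) (semigroup_gen A)"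
  have zero: "0 \<in> ?S"
    unfolding semigroup_gen_def
    by (rule CollectI, rule exI[of _ "\<lambda>_. 0"]) (simp add: nscale_def zero_prod_def[symmetric])
  have add: "u + v \<in> ?S" if uv: "u \<in> ?S" "v \<in> ?S" for u v
  proof -
    obtain l l' where "u = (\<Sum>x\<in>A. nscale (l x) x)" "v = (\<Sum>x\<in>A. nscale (l' x) x)"
      using uv by (auto simp: semigroup_gen_def)
    then have "u + v = (\<Sum>x\<in>A. nscale (l x + l' x) x)"
      by (simp add: nscale_def add_mult_distrib flip: sum.distrib)
    then show ?thesis
      unfolding semigroup_gen_def by (intro CollectI exI[of _ "\<lambda>x. l x + l' x"]) simp
  qed
  have mult: "Poly_Mapping.keys (p * q) \<subseteq> ?S"
    if "Poly_Mapping.keys p \<subseteq> ?S" "Poly_Mapping.keys q \<subseteq> ?S"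
    for p q :: "(nat \<times> nat) \<Rightarrow>\<^sub>0 'k"
    using keys_mult[of p q] that add by fastforce
  have plus: "Poly_Mapping.keys (p + q) \<subseteq> ?S"
    if "Poly_Mapping.keys p \<subseteq> ?S" "Poly_Mapping.keys q \<subseteq> ?S"
    for p q :: "(nat \<times> nat) \<Rightarrow>\<^sub>0 'k"
    using Poly_Mapping.keys_add[of p q] that by blast
  have neg: "\<exists>q. Poly_Mapping.keys q \<subseteq> ?S \<and> q + p = 0"
    if "Poly_Mapping.keys p \<subseteq> ?S" for p :: "(nat \<times> nat) \<Rightarrow>\<^sub>0 'k"
    using that by (intro exI[of _ "- p"]) simp
  show ?thesis
    by (intro cringI abelian_groupI comm_monoidI)
      (use mult plus neg zero in \<open>auto simp: semigroup_ring_def algebra_simps\<close>)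
qed

end

theory Submission
  imports Defs "HOL-Algebra.QuotRing" "HOL-Computational_Algebra.Polynomial"
    "HOL-Library.Product_Lexorder"
begin

text \<open>Let \<open>S\<close> be the semigroup of the arithmetic sequence. Since \<open>a\<close> and \<open>d\<close> are linearly independent, the
elements of \<open>S\<close> are the vectors \<open>na + jd\<close> with \<open>j \<le> kn\<close>, and \<open>n\<close> and \<open>j\<close> are unique
(\<open>semigroup_gen_arith_gens\<close>, \<open>nat_comb_inj\<close>). So \<open>R = K[S]\<close> is a copy of the \<open>k\<close>-th Veronese subring of a
polynomial ring in two variables. Put \<open>x = t\<^sup>a\<close> and \<open>y = t\<^bsup>a+kd\<^esup>\<close>, the monomials on the two
extremal rays. The proof rests on three facts.

\<^item> \<open>R\<close> is Noetherian (\<open>noetherian_if_finite_bases\<close>): by division with respect to leading monomials,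
  an ideal is generated by finitely many elements whose leading exponents generate all its leading
  exponents under translation by \<open>S\<close>. Such finitely many exist by Dickson's lemma for
  \<open>(j, kn - j) \<in> \<nat>\<^sup>2\<close>, since divisibility in \<open>S\<close> is the componentwise order of these pairs.

\<^item> A chain of primes of \<open>R\<close> has at most two steps (\<open>prime_chain_length_le_2\<close>). Three elements
  \<open>f\<^sub>1, f\<^sub>2, f\<^sub>3\<close> of a polynomial ring in two variables are algebraically dependent, because there are more
  products of powers than monomials of the degrees that occur. If \<open>f\<^sub>i \<in> P\<^sub>i - P\<^bsub>i-1\<^esub>\<close>, then
  dividing a relation by the least power of \<open>f\<^sub>1\<close>, then of \<open>f\<^sub>2\<close>, then of \<open>f\<^sub>3\<close> leaves a nonzero
  constant in \<open>P\<^sub>3\<close>.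

\<^item> Every maximal ideal \<open>m\<close> of \<open>R\<close> contains a regular sequence of length two. By a form of Zariski's
  lemma (\<open>maximal_ideal_contains_constant_poly\<close>), \<open>m\<close> contains \<open>p(x)\<close> and \<open>q(y)\<close> for suitable
  nonzero polynomials \<open>p, q\<close> over \<open>K\<close>. The monomials that \<open>x\<close> does not divide form a basis of \<open>R\<close> over
  \<open>K[x]\<close>, which multiplication by \<open>y\<close> shifts by \<open>k\<close> places. So \<open>R\<close> becomes \<open>K[x][W]\<close> with \<open>y\<close> acting as
  \<open>W\<^sup>k\<close>, and there a constant \<open>p\<close> that divides \<open>q(W\<^sup>k) F\<close> divides \<open>F\<close>
  (\<open>regular_sequence_if_free\<close>).

A regular sequence inside \<open>m\<close> stays regular in \<open>R\<^sub>m\<close>, and prime chains of \<open>R\<^sub>m\<close> contract to prime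
chains of \<open>R\<close>, so \<open>2 \<le> depth R\<^sub>m\<close> and \<open>dim R\<^sub>m \<le> 2\<close>. The general inequality
\<open>depth \<le> dim\<close> (\<open>depth_le_krull_dim\<close>) closes the circle; this is the criterion \<open>cohen_macaulayI\<close>.\<close>

section \<open>Prime ideals below a regular element\<close>

lemma (in cring) ideal_adjoin:
  assumes "ideal I R" "a \<in> carrier R"
  obtains J where "ideal J R" "I \<subseteq> J" "a \<in> J"
    "\<And>x. x \<in> J \<Longrightarrow> \<exists>i\<in>I. \<exists>r\<in>carrier R. x = i \<oplus> r \<otimes> a"
proof
  interpret I: ideal I R by fact
  show "ideal (I <+>\<^bsub>R\<^esub> PIdl a) R"
    using assms by (intro add_ideals cgenideal_ideal)
  have mem: "i \<oplus> r \<otimes> a \<in> I <+>\<^bsub>R\<^esub> PIdl a" if "i \<in> I" "r \<in> carrier R" for i r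
    using that by (auto simp: set_add_defs cgenideal_def)
  show "I \<subseteq> I <+>\<^bsub>R\<^esub> PIdl a"
  proof
    fix i assume "i \<in> I"
    with mem[of i \<zero>] assms(2) show "i \<in> I <+>\<^bsub>R\<^esub> PIdl a" by (simp add: I.Icarr)
  qed
  show "a \<in> I <+>\<^bsub>R\<^esub> PIdl a"
    using mem[of \<zero> \<one>] assms(2) by simp
  show "\<exists>i\<in>I. \<exists>r\<in>carrier R. x = i \<oplus> r \<otimes> a" if "x \<in> I <+>\<^bsub>R\<^esub> PIdl a" for x
    using that by (auto simp: set_add_defs cgenideal_def)
qed

text \<open>Krull's argument: an ideal that is maximal among those avoiding \<open>T\<close> is prime. If neither \<open>a\<close> nor
\<open>b\<close> lies in it, adjoining either one meets \<open>T\<close>, and the product of the two witnesses in \<open>T\<close> is a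
multiple of \<open>ab\<close> up to the ideal.\<close>

lemma (in mult_closed) prime_ideal_avoiding:
  assumes "ideal I R" "I \<inter> T = {}"
  obtains P where "primeideal P R" "I \<subseteq> P" "P \<inter> T = {}"
proof -
  let ?A = "{J. ideal J R \<and> I \<subseteq> J \<and> J \<inter> T = {}}"
  have "\<exists>M\<in>?A. \<forall>X\<in>?A. M \<subseteq> X \<longrightarrow> X = M"
  proof (rule subset_Zorn_nonempty)
    show "?A \<noteq> {}" using assms by blast
    fix C assume C: "C \<noteq> {}" "subset.chain ?A C"
    then have "subset.chain {J. ideal J R} C"
      by (auto simp: pred_on.chain_def)
    then have "ideal (\<Union>C) R"
      using chain_Union_is_ideal[of C] C(1) by simp
    with C show "\<Union>C \<in> ?A"
      by (auto simp: pred_on.chain_def; blast)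
  qed
  then obtain P where PA: "P \<in> ?A" and Pmax: "\<forall>X\<in>?A. P \<subseteq> X \<longrightarrow> X = P"
    by (rule bexE)
  from PA have P: "ideal P R" "I \<subseteq> P" "P \<inter> T = {}" by simp_all
  have max: "J = P" if "ideal J R" "P \<subseteq> J" "J \<inter> T = {}" for J
    using Pmax that P(2) by auto
  interpret P: ideal P R by fact
  have meets: "\<exists>t\<in>T. \<exists>p\<in>P. \<exists>r\<in>carrier R. t = p \<oplus> r \<otimes> a" if a: "a \<in> carrier R" "a \<notin> P" for a
  proof -
    obtain J where "ideal J R" "P \<subseteq> J" "a \<in> J"
      "\<And>x. x \<in> J \<Longrightarrow> \<exists>i\<in>P. \<exists>r\<in>carrier R. x = i \<oplus> r \<otimes> a"
      by (rule ideal_adjoin[OF P(1) a(1)]) blast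
    with max[of J] a(2) show ?thesis by fast
  qed
  have "primeideal P R"
  proof (rule primeidealI)
    show "carrier R \<noteq> P" using P(3) T_one by auto
    fix a b assume ab: "a \<in> carrier R" "b \<in> carrier R" "a \<otimes> b \<in> P"
    show "a \<in> P \<or> b \<in> P"
    proof (rule ccontr)
      assume "\<not> (a \<in> P \<or> b \<in> P)"
      with ab meets obtain t p r t' p' r' where
        h: "t \<in> T" "p \<in> P" "r \<in> carrier R" "t = p \<oplus> r \<otimes> a"
        "t' \<in> T" "p' \<in> P" "r' \<in> carrier R" "t' = p' \<oplus> r' \<otimes> b"
        by (metis (no_types))
      note c = h(2,3,6,7) ab P.Icarr
      have "t \<otimes> t' = p \<otimes> (p' \<oplus> r' \<otimes> b) \<oplus> ((r \<otimes> a) \<otimes> p' \<oplus> (r \<otimes> r') \<otimes> (a \<otimes> b))"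
        unfolding h using c by (simp add: l_distr r_distr m_ac a_ac)
      moreover have "\<dots> \<in> P"
        using c by (simp add: P.a_closed P.I_l_closed P.I_r_closed)
      ultimately show False using P(3) T_mult[OF h(1,5)] by auto
    qed
  qed (fact P(1) is_cring)+
  with P that show ?thesis by blast
qed

text \<open>The reason why a regular element lowers the dimension. The set of all \<open>x\<^sup>n s\<close> with \<open>s \<notin> Q\<close> is
multiplicatively closed and avoids \<open>I\<close>, because powers of \<open>x\<close> can be cancelled modulo \<open>I\<close>. A prime
that contains \<open>I\<close> and avoids this set lies inside \<open>Q\<close> and does not contain \<open>x\<close>.\<close>

lemma (in cring) prime_below_regular_element:
  assumes I: "ideal I R" and x: "x \<in> carrier R"
    and reg: "\<And>r. r \<in> carrier R \<Longrightarrow> x \<otimes> r \<in> I \<Longrightarrow> r \<in> I"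
    and Q: "primeideal Q R" "I \<subseteq> Q" "x \<in> Q"
  obtains P where "primeideal P R" "I \<subseteq> P" "P \<subset> Q"
proof -
  interpret Q: primeideal Q R by fact
  interpret I: ideal I R by fact
  have pow: "r \<in> I" if "x [^] n \<otimes> r \<in> I" "r \<in> carrier R" for n :: nat and r
    using that
  proof (induction n arbitrary: r)
    case (Suc n)
    then have "x [^] n \<otimes> (x \<otimes> r) \<in> I" using x by (simp add: m_assoc)
    then have "x \<otimes> r \<in> I" using Suc x by blast
    then show ?case using Suc reg by blast
  qed simp
  have one: "\<one> \<in> carrier R - Q"
    using Q.I_notcarr Q.one_imp_carrier by blast
  define U where "U = {x [^] n \<otimes> s | (n :: nat) s. s \<in> carrier R - Q}"
  have U: "x [^] n \<otimes> s \<in> U" if "s \<in> carrier R - Q" for n :: nat and s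
    using that unfolding U_def by blast
  have UE: thesis
    if "u \<in> U" "\<And>(n :: nat) s. u = x [^] n \<otimes> s \<Longrightarrow> s \<in> carrier R - Q \<Longrightarrow> thesis" for u thesis
    using that unfolding U_def by blast
  interpret U: mult_closed R U
  proof
    show "U \<subseteq> carrier R" using x by (auto elim: UE)
    show "\<one> \<in> U" using U[OF one, of 0] by simp
    fix s s' assume "s \<in> U" "s' \<in> U"
    then obtain n m :: nat and u v where h: "s = x [^] n \<otimes> u" "s' = x [^] m \<otimes> v"
      "u \<in> carrier R - Q" "v \<in> carrier R - Q" by (metis UE)
    then have "s \<otimes> s' = x [^] (n + m) \<otimes> (u \<otimes> v)"
      using x by (simp add: nat_pow_mult[symmetric] m_ac)
    moreover have "u \<otimes> v \<in> carrier R - Q"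
      using h Q.I_prime[of u v] by blast
    ultimately show "s \<otimes> s' \<in> U" using U by simp
  qed
  have "u \<notin> I" if "u \<in> U" for u
    using that pow Q(2) by (auto elim!: UE)
  then obtain P where P: "primeideal P R" "I \<subseteq> P" "P \<inter> U = {}"
    using U.prime_ideal_avoiding[OF I] by blast
  have "P \<subseteq> carrier R"
    using P(1) by (meson ideal.Icarr primeideal.axioms(1) subsetI)
  moreover have "x \<in> U" using U[OF one, of 1] x by simp
  moreover have "s \<in> U" if "s \<in> carrier R - Q" for s
    using U[OF that, of 0] that by simp
  ultimately have "P \<subset> Q" using P(3) Q(3) by blast
  with P that show ?thesis by blast
qed

definition prime_chain :: "('a, 'b) ring_scheme \<Rightarrow> nat \<Rightarrow> (nat \<Rightarrow> 'a set) \<Rightarrow> bool" where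
  "prime_chain R n P \<longleftrightarrow> (\<forall>i\<le>n. primeideal (P i) R) \<and> (\<forall>i<n. P i \<subset> P (Suc i))"

lemma krull_dim_prime_chain: "krull_dim R = Sup {enat n | n. \<exists>P. prime_chain R n P}"
  by (simp add: krull_dim_def prime_chain_def)

text \<open>The chain grows downwards from \<open>Q\<close>: its lowest member contains the first \<open>n - m\<close> elements of the
sequence, and the last of these is regular modulo its predecessors, so there is a smaller prime that
still contains the predecessors.\<close>

lemma (in cring) regular_sequence_prime_chain:
  assumes reg: "regular_sequence R xs" and Q: "primeideal Q R" "set xs \<subseteq> Q"
  shows "\<exists>P. prime_chain R (length xs) P"
proof -
  have car: "set xs \<subseteq> carrier R" using reg by (simp add: regular_sequence_def)
  have "\<exists>P. prime_chain R m P \<and> set (take (length xs - m) xs) \<subseteq> P 0" if "m \<le> length xs" for m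
    using that
  proof (induction m)
    case 0
    show ?case using Q by (intro exI[of _ "\<lambda>_. Q"]) (auto simp: prime_chain_def)
  next
    case (Suc m)
    then obtain P where P: "prime_chain R m P" "set (take (length xs - m) xs) \<subseteq> P 0" by auto
    define l where "l = length xs - Suc m"
    have l: "l < length xs" "length xs - m = Suc l" using Suc(2) by (auto simp: l_def)
    have sub: "set (take l xs) \<subseteq> carrier R" using car set_take_subset by fast
    have xl: "xs ! l \<in> carrier R" using car nth_mem[OF l(1)] by blast
    have P0: "primeideal (P 0) R" "xs ! l \<in> P 0" "set (take l xs) \<subseteq> P 0"
      using P l by (auto simp: prime_chain_def take_Suc_conv_app_nth)
    obtain P' where P': "primeideal P' R" "Idl (set (take l xs)) \<subseteq> P'" "P' \<subset> P 0"
    proof (rule prime_below_regular_element[of "Idl (set (take l xs))" "xs ! l" "P 0", OF _ xl _ P0(1) _ P0(2)])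
      show "ideal (Idl (set (take l xs))) R" using sub by (rule genideal_ideal)
      show "Idl (set (take l xs)) \<subseteq> P 0"
        using P0 by (intro genideal_minimal primeideal.axioms(1))
      show "r \<in> Idl (set (take l xs))"
        if "r \<in> carrier R" "xs ! l \<otimes> r \<in> Idl (set (take l xs))" for r
        using reg l that by (simp add: regular_sequence_def)
    qed
    have "prime_chain R (Suc m) (case_nat P' P)"
      using P(1) P' by (auto simp: prime_chain_def le_Suc_eq split: nat.splits)
    moreover have "set (take l xs) \<subseteq> P'" using P'(2) genideal_self[OF sub] by blast
    ultimately show ?case by (intro exI[of _ "case_nat P' P"]) (auto simp: l_def)
  qed
  from this[of "length xs"] show ?thesis by blast
qed

lemma (in cring) depth_le_krull_dim:
  assumes "primeideal Q R"
  shows "depth R Q \<le> krull_dim R"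
  unfolding depth_def krull_dim_prime_chain
proof (rule Sup_mono)
  fix e assume "e \<in> {enat (length xs) | xs. regular_sequence R xs \<and> set xs \<subseteq> Q}"
  then obtain xs where xs: "e = enat (length xs)" "regular_sequence R xs" "set xs \<subseteq> Q"
    by (elim CollectE exE conjE)
  then have "e \<in> {enat n | n. \<exists>P. prime_chain R n P}"
    using regular_sequence_prime_chain[OF xs(2) assms xs(3)] by simp
  then show "\<exists>b\<in>{enat n | n. \<exists>P. prime_chain R n P}. e \<le> b"
    by (rule bexI[rotated]) simp
qed

section \<open>Localization at a prime ideal\<close>

context mult_closed
begin

abbreviation "Loc \<equiv> localization R T"
abbreviation "fraction \<equiv> loc_frac R T"

lemma loc_carrier: "X \<in> carrier Loc \<longleftrightarrow> (\<exists>r\<in>carrier R. \<exists>s\<in>T. X = fraction r s)"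
  by (auto simp: localization_def)

lemma fraction_closed: "r \<in> carrier R \<Longrightarrow> s \<in> T \<Longrightarrow> fraction r s \<in> carrier Loc"
  by (auto simp: loc_carrier)

lemma loc_one: "\<one>\<^bsub>Loc\<^esub> = fraction \<one> \<one>"
  by (simp add: localization_def)

lemma fraction_eqI:
  assumes "r \<otimes> s' = r' \<otimes> s" "r \<in> carrier R" "s \<in> T" "r' \<in> carrier R" "s' \<in> T"
  shows "fraction r s = fraction r' s'"
  using assms T_one by (subst loc_frac_eq_iff) auto

lemma loc_hom: "ring_hom_ring R Loc (\<lambda>r. fraction r \<one>)"
  by (intro ring_hom_ringI2 ring_hom_memI ring_axioms cring.axioms(1) localization_cring)
    (use T_one in \<open>auto simp: loc_carrier localization_mult localization_add loc_one\<close>)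

definition contraction :: "('a \<times> 'a) set set \<Rightarrow> 'a set" where
  "contraction J = {r \<in> carrier R. fraction r \<one> \<in> J}"

definition extension :: "'a set \<Rightarrow> ('a \<times> 'a) set set" where
  "extension I = {fraction r s | r s. r \<in> I \<and> s \<in> T}"

lemma fraction_extension: "r \<in> I \<Longrightarrow> s \<in> T \<Longrightarrow> fraction r s \<in> extension I"
  by (auto simp: extension_def)

lemma ideal_contraction: "ideal J Loc \<Longrightarrow> ideal (contraction J) R"
  using ring_hom_ring.ideal_vimage[of R Loc "\<lambda>r. fraction r \<one>" J] loc_hom
  by (simp add: contraction_def)

lemma primeideal_contraction: "primeideal J Loc \<Longrightarrow> primeideal (contraction J) R"
  using ring_hom_ring.primeideal_vimage[of R Loc "\<lambda>r. fraction r \<one>" J] loc_hom is_cring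
  by (simp add: contraction_def)

lemma fraction_mem_ideal_iff:
  assumes "ideal J Loc" "r \<in> carrier R" "s \<in> T"
  shows "fraction r s \<in> J \<longleftrightarrow> r \<in> contraction J"
proof -
  interpret J: ideal J Loc by fact
  have "fraction s \<one> \<otimes>\<^bsub>Loc\<^esub> fraction r s = fraction (s \<otimes> r) (\<one> \<otimes> s)"
    using assms T_one by (intro localization_mult) auto
  also have "\<dots> = fraction r \<one>"
    using assms T_one by (intro fraction_eqI) (auto simp: m_comm)
  finally have "fraction r \<one> = fraction s \<one> \<otimes>\<^bsub>Loc\<^esub> fraction r s" ..
  moreover have "fraction r s = fraction \<one> s \<otimes>\<^bsub>Loc\<^esub> fraction r \<one>"
    using assms T_one by (simp add: localization_mult)
  moreover have "fraction s \<one> \<in> carrier Loc" "fraction \<one> s \<in> carrier Loc"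
    using assms T_one by (auto simp: loc_carrier)
  ultimately show ?thesis
    using assms(2) J.I_l_closed unfolding contraction_def by fastforce
qed

lemma extension_contraction:
  assumes "ideal J Loc"
  shows "extension (contraction J) = J"
proof -
  interpret J: ideal J Loc by fact
  have "X \<in> extension (contraction J)" if X: "X \<in> J" for X
  proof -
    obtain r s where rs: "r \<in> carrier R" "s \<in> T" "X = fraction r s"
      using J.Icarr[OF X] by (auto simp: loc_carrier)
    then show ?thesis
      using X fraction_mem_ideal_iff[OF assms] by (auto simp: extension_def)
  qed
  moreover have "fraction r s \<in> J" if "r \<in> contraction J" "s \<in> T" for r s
    using that fraction_mem_ideal_iff[OF assms] by (auto simp: contraction_def)
  ultimately show ?thesis by (auto simp: extension_def)
qed

lemma ideal_extension:
  assumes "ideal I R"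
  shows "ideal (extension I) Loc"
proof -
  interpret I: ideal I R by fact
  interpret L: cring Loc by (rule localization_cring)
  have ext: "fraction r s \<in> extension I" if "r \<in> I" "s \<in> T" for r s
    using that by (auto simp: extension_def)
  have mult: "X \<otimes>\<^bsub>Loc\<^esub> Y \<in> extension I" if X: "X \<in> extension I" and Y: "Y \<in> carrier Loc" for X Y
  proof -
    obtain r s where "X = fraction r s" "r \<in> I" "s \<in> T"
      using X by (auto simp: extension_def)
    moreover obtain r' s' where "Y = fraction r' s'" "r' \<in> carrier R" "s' \<in> T"
      using Y by (auto simp: loc_carrier)
    ultimately show ?thesis
      using I.I_r_closed T_mult by (auto simp: localization_mult I.Icarr intro!: ext)
  qed
  have sub: "extension I \<subseteq> carrier Loc"
    using I.Icarr fraction_closed by (auto simp: extension_def)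
  show ?thesis
  proof (rule idealI)
    show "subgroup (extension I) (add_monoid Loc)"
    proof (rule L.add.subgroupI)
      show "extension I \<noteq> {}" using ext[OF I.zero_closed T_one] by blast
    next
      fix X assume "X \<in> extension I"
      then show "\<ominus>\<^bsub>Loc\<^esub> X \<in> extension I"
        using mult[of X "\<ominus>\<^bsub>Loc\<^esub> \<one>\<^bsub>Loc\<^esub>"] sub L.r_minus[of X "\<one>\<^bsub>Loc\<^esub>"] by auto
    next
      fix X Y assume "X \<in> extension I" "Y \<in> extension I"
      then obtain r s r' s' where h: "X = fraction r s" "Y = fraction r' s'" "r \<in> I" "s \<in> T" "r' \<in> I" "s' \<in> T"
        by (auto simp: extension_def)
      then show "X \<oplus>\<^bsub>Loc\<^esub> Y \<in> extension I"
        using I.I_r_closed T_mult by (auto simp: localization_add I.Icarr intro!: ext)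
    qed (use sub in simp)
  qed (use mult sub L.m_comm in \<open>auto simp: L.ring_axioms\<close>)
qed

lemma fraction_mem_extension_iff:
  assumes "ideal I R" "r \<in> carrier R" "s \<in> T"
  shows "fraction r s \<in> extension I \<longleftrightarrow> (\<exists>u\<in>T. u \<otimes> r \<in> I)"
proof -
  interpret I: ideal I R by fact
  show ?thesis
  proof
    assume "fraction r s \<in> extension I"
    then obtain r' s' where h: "fraction r s = fraction r' s'" "r' \<in> I" "s' \<in> T"
      by (auto simp: extension_def)
    then obtain u where u: "u \<in> T" "u \<otimes> (r \<otimes> s') = u \<otimes> (r' \<otimes> s)"
      using loc_frac_eq_iff[of r s r' s'] assms I.Icarr by auto
    have "(u \<otimes> s') \<otimes> r = (u \<otimes> s) \<otimes> r'"
      using u h assms I.Icarr by (simp add: m_ac)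
    then show "\<exists>u\<in>T. u \<otimes> r \<in> I"
      using u(1) h assms T_mult I.I_l_closed by (intro bexI[of _ "u \<otimes> s'"]) auto
  next
    assume "\<exists>u\<in>T. u \<otimes> r \<in> I"
    then obtain u where u: "u \<in> T" "u \<otimes> r \<in> I" by blast
    then have "fraction r s = fraction (u \<otimes> r) (u \<otimes> s)"
      using assms T_mult by (intro fraction_eqI) (auto simp: m_ac)
    then show "fraction r s \<in> extension I"
      using u assms T_mult by (simp add: fraction_extension)
  qed
qed

text \<open>Generation of ideals commutes with localization; this transports both finite generation and the
conditions that define a regular sequence.\<close>

lemma Idl_image_eq_extension:
  assumes "X \<subseteq> carrier R"
  shows "Idl\<^bsub>Loc\<^esub> ((\<lambda>r. fraction r \<one>) ` X) = extension (Idl X)"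
proof -
  interpret L: cring Loc by (rule localization_cring)
  have img: "(\<lambda>r. fraction r \<one>) ` X \<subseteq> carrier Loc"
    using assms T_one by (auto intro!: fraction_closed)
  let ?J = "Idl\<^bsub>Loc\<^esub> ((\<lambda>r. fraction r \<one>) ` X)"
  have J: "ideal ?J Loc" using img by (rule L.genideal_ideal)
  have "Idl X \<subseteq> contraction ?J"
    using L.genideal_self[OF img] assms ideal_contraction[OF J]
    by (intro genideal_minimal) (auto simp: contraction_def)
  then have "extension (Idl X) \<subseteq> ?J"
    using extension_contraction[OF J] by (auto simp: extension_def)
  moreover have "?J \<subseteq> extension (Idl X)"
    using genideal_self[OF assms] T_one assms
    by (intro L.genideal_minimal ideal_extension genideal_ideal) (auto simp: extension_def)
  ultimately show ?thesis by blast
qed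

lemma noetherian_localization:
  assumes "noetherian_ring R"
  shows "noetherian_ring Loc"
proof -
  interpret L: cring Loc by (rule localization_cring)
  show ?thesis
  proof (rule L.noetherian_ringI)
    fix J assume J: "ideal J Loc"
    obtain A where A: "A \<subseteq> carrier R" "finite A" "contraction J = Idl A"
      using noetherian_ring.finetely_gen[OF assms ideal_contraction[OF J]] by blast
    have "J = Idl\<^bsub>Loc\<^esub> ((\<lambda>r. fraction r \<one>) ` A)"
      using Idl_image_eq_extension[OF A(1)] extension_contraction[OF J] A(3) by simp
    then show "\<exists>B\<subseteq>carrier Loc. finite B \<and> J = Idl\<^bsub>Loc\<^esub> B"
      using A T_one by (intro exI[of _ "(\<lambda>r. fraction r \<one>) ` A"]) (auto intro!: fraction_closed)
  qed
qed

lemma prime_chain_contraction: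
  assumes "prime_chain Loc n P"
  shows "prime_chain R n (\<lambda>i. contraction (P i))"
proof -
  have pr: "primeideal (P i) Loc" if "i \<le> n" for i using assms that by (simp add: prime_chain_def)
  have "contraction (P i) \<subset> contraction (P (Suc i))" if "i < n" for i
  proof
    show "contraction (P i) \<subseteq> contraction (P (Suc i))"
      using assms that by (auto simp: prime_chain_def contraction_def)
    show "contraction (P i) \<noteq> contraction (P (Suc i))"
      using assms that extension_contraction[OF primeideal.axioms(1)[OF pr]]
      by (metis less_imp_le_nat Suc_leI prime_chain_def psubset_eq)
  qed
  with pr primeideal_contraction show ?thesis by (simp add: prime_chain_def)
qed

text \<open>Flatness of localization, by clearing denominators: membership of a fraction in an extended ideal
means membership of its numerator after multiplication by an element of \<open>T\<close>. The sequence has to lie in an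
ideal that avoids \<open>T\<close> so that it does not generate the unit ideal.\<close>

lemma regular_sequence_localization:
  assumes reg: "regular_sequence R xs" and I: "ideal I R" "set xs \<subseteq> I" "I \<inter> T = {}"
  shows "regular_sequence Loc (map (\<lambda>r. fraction r \<one>) xs)"
proof -
  let ?f = "\<lambda>r. fraction r \<one>"
  have car: "set xs \<subseteq> carrier R" using reg by (simp add: regular_sequence_def)
  have take: "Idl\<^bsub>Loc\<^esub> (set (take i (map ?f xs))) = extension (Idl (set (take i xs)))" for i
    using Idl_image_eq_extension[of "set (take i xs)"] car set_take_subset[of i xs]
    by (simp add: take_map)
  have Idl: "ideal (Idl (set (take i xs))) R" for i
    using car set_take_subset[of i xs] by (intro genideal_ideal) auto
  show ?thesis
    unfolding regular_sequence_def
  proof (intro conjI allI ballI impI)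
    show "set (map ?f xs) \<subseteq> carrier Loc"
      using car T_one by (auto intro!: fraction_closed)
  next
    fix i X assume i: "i < length (map ?f xs)" and X: "X \<in> carrier Loc"
      and mem: "map ?f xs ! i \<otimes>\<^bsub>Loc\<^esub> X \<in> Idl\<^bsub>Loc\<^esub> (set (take i (map ?f xs)))"
    obtain r s where rs: "r \<in> carrier R" "s \<in> T" "X = fraction r s" using X by (auto simp: loc_carrier)
    have xi: "xs ! i \<in> carrier R" using car i by auto
    have "fraction (xs ! i \<otimes> r) (\<one> \<otimes> s) \<in> extension (Idl (set (take i xs)))"
      using mem i rs xi T_one by (simp add: take localization_mult)
    then obtain u where u: "u \<in> T" "u \<otimes> (xs ! i \<otimes> r) \<in> Idl (set (take i xs))"
      using rs xi fraction_mem_extension_iff[OF Idl] by auto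
    then have "xs ! i \<otimes> (u \<otimes> r) \<in> Idl (set (take i xs))"
      using rs xi by (simp add: m_ac)
    then have "u \<otimes> r \<in> Idl (set (take i xs))"
      using reg i u(1) rs(1) by (simp add: regular_sequence_def)
    then show "X \<in> Idl\<^bsub>Loc\<^esub> (set (take i (map ?f xs)))"
      using u(1) rs fraction_mem_extension_iff[OF Idl] by (auto simp: take)
  next
    have "Idl\<^bsub>Loc\<^esub> (set (map ?f xs)) = extension (Idl (set xs))"
      using take[of "length xs"] by simp
    moreover have "\<one>\<^bsub>Loc\<^esub> \<notin> extension (Idl (set xs))"
      using fraction_mem_extension_iff[OF Idl[of "length xs"], of \<one> \<one>] T_one I(3)
        genideal_minimal[OF I(1,2)] by (auto simp: loc_one)
    moreover have "\<one>\<^bsub>Loc\<^esub> \<in> carrier Loc" using T_one by (auto simp: loc_one loc_carrier)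
    ultimately show "Idl\<^bsub>Loc\<^esub> (set (map ?f xs)) \<noteq> carrier Loc" by metis
  qed
qed

end

context primeideal
begin

lemma mult_closed_complement: "mult_closed R (carrier R - I)"
proof -
  have "\<one> \<notin> I"
    using I_notcarr one_imp_carrier by blast
  then show ?thesis
    using I_prime by unfold_locales auto
qed

interpretation M: mult_closed R "carrier R - I"
  by (rule mult_closed_complement)

text \<open>A fraction whose numerator is outside the prime \<open>I\<close> is a unit, so every proper ideal lies in the
extension of \<open>I\<close>.\<close>

lemma maximalideals_local_at: "{J. maximalideal J (local_at R I)} = {M.extension I}"
proof -
  interpret L: cring M.Loc by (rule M.localization_cring)
  have ext: "ideal (M.extension I) M.Loc" by (rule M.ideal_extension[OF is_ideal])
  have ext_mem: "M.fraction r s \<in> M.extension I \<longleftrightarrow> r \<in> I" if "r \<in> carrier R" "s \<in> carrier R - I" for r s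
  proof -
    have "u \<otimes> r \<in> I \<longleftrightarrow> r \<in> I" if "u \<in> carrier R - I" for u
      using that \<open>r \<in> carrier R\<close> I_prime[of u r] I_l_closed[of r u] by blast
    then show ?thesis
      using M.fraction_mem_extension_iff[OF is_ideal that] M.T_one by blast
  qed
  have one: "\<one> \<in> carrier R - I" using M.T_one .
  have proper: "M.extension I \<noteq> carrier M.Loc"
    using ext_mem[of \<one> \<one>] one L.one_closed by (auto simp: M.loc_one)
  have sub: "J \<subseteq> M.extension I" if J: "ideal J M.Loc" "J \<noteq> carrier M.Loc" for J
  proof
    interpret J: ideal J M.Loc by fact
    fix X assume X: "X \<in> J"
    then obtain r s where rs: "r \<in> carrier R" "s \<in> carrier R - I" "X = M.fraction r s"
      using J.Icarr[OF X] unfolding M.loc_carrier by blast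
    have "r \<in> I"
    proof (rule ccontr)
      assume r: "r \<notin> I"
      have "M.fraction s r \<otimes>\<^bsub>M.Loc\<^esub> X = \<one>\<^bsub>M.Loc\<^esub>"
        using rs r one I_prime[of r s]
        by (simp add: M.localization_mult M.loc_one) (rule M.fraction_eqI, auto simp: m_ac)
      moreover have "M.fraction s r \<in> carrier M.Loc" using rs r by (auto simp: M.loc_carrier)
      ultimately have "\<one>\<^bsub>M.Loc\<^esub> \<in> J" using J.I_l_closed[OF X] by metis
      then show False using J(2) J.one_imp_carrier by blast
    qed
    then show "X \<in> M.extension I" using rs ext_mem by blast
  qed
  have "maximalideal (M.extension I) M.Loc"
    using ext proper sub by (intro maximalidealI) auto
  moreover have "J = M.extension I" if "maximalideal J M.Loc" for J
  proof -
    interpret J: maximalideal J M.Loc by fact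
    show ?thesis
      using J.I_maximal[OF ext] sub[OF J.is_ideal] J.I_notcarr proper
        ideal.Icarr[OF ext] by blast
  qed
  ultimately show ?thesis unfolding local_at_def by blast
qed

text \<open>The three inequalities \<open>n \<le> depth \<le> dim \<le> n\<close>, the middle one holding in every local ring.\<close>

lemma cohen_macaulay_local_at:
  assumes noeth: "noetherian_ring R"
    and dim: "\<And>l P. prime_chain R l P \<Longrightarrow> l \<le> n"
    and reg: "regular_sequence R xs" "set xs \<subseteq> I" "length xs = n"
  shows "cohen_macaulay_local (local_at R I)"
proof -
  interpret L: cring M.Loc by (rule M.localization_cring)
  let ?m = "M.extension I"
  have max: "maximalideal ?m M.Loc"
    using maximalideals_local_at by (auto simp: local_at_def)
  have "krull_dim M.Loc \<le> enat n"
    unfolding krull_dim_prime_chain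
    using dim[OF M.prime_chain_contraction] by (intro Sup_least) auto
  moreover have "depth M.Loc ?m \<le> krull_dim M.Loc"
    by (intro L.depth_le_krull_dim L.maximalideal_prime max)
  moreover have "enat n \<le> depth M.Loc ?m"
    unfolding depth_def
  proof (intro Sup_upper CollectI exI conjI)
    let ?ys = "map (\<lambda>r. M.fraction r \<one>) xs"
    show "regular_sequence M.Loc ?ys"
      by (rule M.regular_sequence_localization[OF reg(1) is_ideal reg(2)]) auto
    show "set ?ys \<subseteq> ?m"
      using reg(2) M.T_one by (auto simp: M.extension_def)
    show "enat n = enat (length ?ys)" using reg(3) by simp
  qed
  ultimately have "depth M.Loc ?m = krull_dim M.Loc" by order
  then show ?thesis
    using maximalideals_local_at M.noetherian_localization[OF noeth] L.is_cring
    unfolding cohen_macaulay_local_def local_at_def by blast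
qed

end

lemma cohen_macaulayI:
  assumes "cring R" "noetherian_ring R"
    and "\<And>l P. prime_chain R l P \<Longrightarrow> l \<le> n"
    and "\<And>m. maximalideal m R \<Longrightarrow> \<exists>xs. regular_sequence R xs \<and> set xs \<subseteq> m \<and> length xs = n"
  shows "cohen_macaulay R"
  unfolding cohen_macaulay_def
proof (intro conjI allI impI)
  fix m assume m: "maximalideal m R"
  then obtain xs where "regular_sequence R xs" "set xs \<subseteq> m" "length xs = n"
    using assms(4) by blast
  then show "cohen_macaulay_local (local_at R m)"
    using primeideal.cohen_macaulay_local_at[OF cring.maximalideal_prime[OF assms(1) m] assms(2)] assms(3)
    by blast
qed (fact assms)+

section \<open>Semigroup rings inside the polynomial ring in two variables\<close>

text \<open>That \<open>S\<close> is a submonoid of \<open>\<nat>\<^sup>2\<close> is expressed by the ring axioms of its semigroup ring, from which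
\<open>zero_mem\<close> and \<open>add_mem\<close> below recover it. The operations of this ring are those of the
surrounding polynomial ring, so that ideals can be handled with the notation of type classes.\<close>

locale semigroup_algebra = cring "semigroup_ring K S"
  for K :: "'k::field itself" and S
begin

abbreviation "R \<equiv> semigroup_ring K S"

lemma carrier_iff: "p \<in> carrier R \<longleftrightarrow> Poly_Mapping.keys p \<subseteq> S"
  by (simp add: semigroup_ring_def)

lemma ring_ops [simp]:
  "p \<otimes>\<^bsub>R\<^esub> q = p * q" "p \<oplus>\<^bsub>R\<^esub> q = p + q" "\<one>\<^bsub>R\<^esub> = 1" "\<zero>\<^bsub>R\<^esub> = 0"
  by (simp_all add: semigroup_ring_def)

lemma carrier_mult [intro]: "p \<in> carrier R \<Longrightarrow> q \<in> carrier R \<Longrightarrow> p * q \<in> carrier R"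
  using m_closed by simp

lemma carrier_add [intro]: "p \<in> carrier R \<Longrightarrow> q \<in> carrier R \<Longrightarrow> p + q \<in> carrier R"
  using a_closed by simp

lemma carrier_one [simp]: "1 \<in> carrier R"
  using one_closed by simp

lemma carrier_zero [simp]: "0 \<in> carrier R"
  using zero_closed by simp

lemma carrier_power [intro]: "p \<in> carrier R \<Longrightarrow> p ^ n \<in> carrier R"
  by (induction n) auto

lemma carrier_sum: "(\<And>e. e \<in> E \<Longrightarrow> g e \<in> carrier R) \<Longrightarrow> sum g E \<in> carrier R"
  by (induction E rule: infinite_finite_induct) auto

lemma zero_mem: "0 \<in> S"
  using carrier_one by (simp add: carrier_iff)

lemma carrier_single: "s \<in> S \<Longrightarrow> Poly_Mapping.single s c \<in> carrier R"
  by (simp add: carrier_iff)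

lemma add_mem:
  assumes "s \<in> S" "t \<in> S"
  shows "s + t \<in> S"
  using carrier_mult[OF carrier_single[OF assms(1), of 1] carrier_single[OF assms(2), of 1]]
  by (simp add: mult_single carrier_iff)

lemma carrier_const: "Poly_Mapping.single 0 c \<in> carrier R"
  by (intro carrier_single zero_mem)

lemma carrier_diff [intro]:
  assumes "p \<in> carrier R" "q \<in> carrier R"
  shows "p - q \<in> carrier R"
  using assms keys_diff[of p q] unfolding carrier_iff by blast

lemma ideal_carrier: "ideal I R \<Longrightarrow> p \<in> I \<Longrightarrow> p \<in> carrier R"
  by (rule ideal.Icarr)

lemma ideal_zero: "ideal I R \<Longrightarrow> 0 \<in> I"
  using additive_subgroup.zero_closed[of I R] by (simp add: ideal.axioms)

lemma ideal_add: "ideal I R \<Longrightarrow> p \<in> I \<Longrightarrow> q \<in> I \<Longrightarrow> p + q \<in> I"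
  using additive_subgroup.a_closed[of I R p q] by (simp add: ideal.axioms)

lemma ideal_mult: "ideal I R \<Longrightarrow> p \<in> I \<Longrightarrow> q \<in> carrier R \<Longrightarrow> q * p \<in> I"
  using ideal.I_l_closed[of I R p q] by simp

lemma ideal_diff:
  assumes "ideal I R" "p \<in> I" "q \<in> I"
  shows "p - q \<in> I"
proof -
  have "- 1 \<in> carrier R"
    using carrier_diff[of 0 1] by simp
  from ideal_add[OF assms(1,2) ideal_mult[OF assms(1,3) this]] show ?thesis by simp
qed

lemma ideal_sum: "ideal I R \<Longrightarrow> (\<And>e. e \<in> E \<Longrightarrow> g e \<in> I) \<Longrightarrow> sum g E \<in> I"
  by (induction E rule: infinite_finite_induct) (auto simp: ideal_zero ideal_add)

lemma proper_ideal_const: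
  assumes "ideal I R" "I \<noteq> carrier R" "Poly_Mapping.single 0 c \<in> I"
  shows "c = 0"
proof (rule ccontr)
  assume "c \<noteq> 0"
  then have "1 \<in> I"
    using ideal_mult[OF assms(1,3) carrier_const[of "1 / c"]] by (simp add: mult_single)
  with assms ideal.one_imp_carrier show False by fastforce
qed

end

section \<open>Chains of prime ideals\<close>

text \<open>More vectors than the dimension of the span of the monomials in \<open>B\<close>. A family \<open>\<phi>\<close> that is not
injective is treated separately, since linear dependence of its image says nothing about a repeated vector.\<close>

lemma linear_relation_if_few_keys:
  fixes \<phi> :: "'e \<Rightarrow> 'a::comm_monoid_add \<Rightarrow>\<^sub>0 'k::field"
  assumes "finite B" and keys: "\<And>e. e \<in> E \<Longrightarrow> Poly_Mapping.keys (\<phi> e) \<subseteq> B" and card: "card B < card E"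
  shows "\<exists>c. (\<exists>e\<in>E. c e \<noteq> 0) \<and> (\<Sum>e\<in>E. Poly_Mapping.single 0 (c e) * \<phi> e) = 0"
proof -
  have fin: "finite E" using card card.infinite by fastforce
  let ?s = "\<lambda>c (p :: 'a \<Rightarrow>\<^sub>0 'k). Poly_Mapping.single 0 c * p"
  interpret vector_space ?s
    by unfold_locales (simp_all add: algebra_simps single_add mult_single flip: mult.assoc)
  show ?thesis
  proof (cases "inj_on \<phi> E")
    case True
    let ?B = "(\<lambda>b. Poly_Mapping.single b (1 :: 'k)) ` B"
    have "p \<in> span ?B" if "Poly_Mapping.keys p \<subseteq> B" for p
    proof -
      have "p = (\<Sum>b\<in>Poly_Mapping.keys p. ?s (Poly_Mapping.lookup p b) (Poly_Mapping.single b 1))"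
        by (rule poly_mapping_eqI)
          (simp add: mult_single lookup_sum lookup_single when_def in_keys_iff)
      also have "\<dots> \<in> span ?B"
        using that by (intro span_sum span_scale span_base) auto
      finally show ?thesis .
    qed
    then have sub: "\<phi> ` E \<subseteq> span ?B" using keys by blast
    have "dependent (\<phi> ` E)"
    proof (rule ccontr)
      assume "independent (\<phi> ` E)"
      then have "card (\<phi> ` E) \<le> card ?B"
        using independent_span_bound[OF _ _ sub] assms(1) by blast
      also have "\<dots> \<le> card B" using assms(1) by (rule card_image_le)
      finally show False using card card_image[OF True] by simp
    qed
    then obtain u where u: "\<exists>v\<in>\<phi> ` E. u v \<noteq> 0" "(\<Sum>v\<in>\<phi> ` E. ?s (u v) v) = 0"
      using dependent_finite[of "\<phi> ` E"] fin by auto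
    then show ?thesis
      using sum.reindex[OF True, of "\<lambda>v. ?s (u v) v"]
      by (intro exI[of _ "u \<circ> \<phi>"]) auto
  next
    case False
    then obtain e e' where e: "e \<in> E" "e' \<in> E" "e \<noteq> e'" "\<phi> e = \<phi> e'" by (auto simp: inj_on_def)
    let ?c = "\<lambda>x. if x = e then 1 else if x = e' then - 1 else 0 :: 'k"
    have "(\<Sum>x\<in>E. ?s (?c x) (\<phi> x)) = (\<Sum>x\<in>{e, e'}. ?s (?c x) (\<phi> x))"
      using fin e by (intro sum.mono_neutral_right) auto
    also have "\<dots> = 0" using e by (simp add: single_uminus)
    finally show ?thesis using e(1) by (intro exI[of _ ?c]) auto
  qed
qed

lemma minimizers_nonempty:
  fixes f :: "'e \<Rightarrow> nat"
  assumes "finite E" "E \<noteq> {}"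
  shows "{e \<in> E. f e = Min (f ` E)} \<noteq> {}"
proof -
  have "Min (f ` E) \<in> f ` E" using assms by (intro Min_in) auto
  then show ?thesis by auto
qed

text \<open>With exponents below \<open>m\<close> there are \<open>m\<^sup>3\<close> products \<open>f\<^sup>i g\<^sup>j h\<^sup>l\<close>, and their monomials lie in a
square with \<open>(3mN + 1)\<^sup>2\<close> points if \<open>N\<close> bounds the exponents in \<open>f, g, h\<close>. The cubic wins for large
\<open>m\<close>. The factors of each term are nested so that one power can be split off at a time.\<close>

lemma ex_algebraic_relation:
  fixes f g h :: "nat \<times> nat \<Rightarrow>\<^sub>0 'k::field"
  obtains c :: "nat \<times> nat \<times> nat \<Rightarrow> 'k" and E where "finite E" "E \<noteq> {}" "\<And>e. e \<in> E \<Longrightarrow> c e \<noteq> 0"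
    "(\<Sum>(i, j, l)\<in>E. f ^ i * (g ^ j * (h ^ l * Poly_Mapping.single 0 (c (i, j, l))))) = 0"
proof -
  define bd where "bd N p \<longleftrightarrow> Poly_Mapping.keys p \<subseteq> {0..N} \<times> {0..N}" for N and p :: "nat \<times> nat \<Rightarrow>\<^sub>0 'k"
  have mono: "bd N p" if "bd M p" "M \<le> N" for M N p
    using that by (fastforce simp: bd_def)
  have mult: "bd (M + N) (p * q)" if "bd M p" "bd N q" for M N p q
    using that keys_mult[of p q] unfolding bd_def by fastforce
  have power: "bd (n * N) (p ^ n)" if "bd N p" for n N p
  proof (induction n)
    case 0 show ?case by (simp add: bd_def zero_prod_def)
  next
    case (Suc n) then show ?case using mult[OF that Suc] by simp
  qed
  have ex: "\<exists>N. bd N p" for p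
  proof -
    let ?N = "Max (insert 0 (fst ` Poly_Mapping.keys p \<union> snd ` Poly_Mapping.keys p))"
    have "a \<le> ?N \<and> b \<le> ?N" if "(a, b) \<in> Poly_Mapping.keys p" for a b
      using that by (intro conjI Max_ge) force+
    then show ?thesis unfolding bd_def by (intro exI[of _ ?N]) auto
  qed
  obtain N1 N2 N3 where "bd N1 f" "bd N2 g" "bd N3 h" using ex by metis
  then obtain N where N: "bd N f" "bd N g" "bd N h"
    using mono[of N1 f "max N1 (max N2 N3)"] mono[of N2 g "max N1 (max N2 N3)"]
      mono[of N3 h "max N1 (max N2 N3)"] by auto
  \<comment> \<open>large enough for \<open>(3 * m * N + 1)\<^sup>2 \<le> m\<^sup>2 * (3 * N + 1)\<^sup>2 < m ^ 3\<close>\<close>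
  define m where "m = (3 * N + 1)\<^sup>2 + 1"
  let ?E = "{..<m} \<times> {..<m} \<times> {..<m}"
  let ?\<phi> = "\<lambda>(i, j, l). f ^ i * (g ^ j * h ^ l)"
  let ?B = "{0..3 * m * N} \<times> {0..3 * m * N}"
  have "card ?B = (3 * m * N + 1)\<^sup>2" by (simp add: power2_eq_square)
  also have "\<dots> \<le> (m * (3 * N + 1))\<^sup>2"
    by (intro power_mono) (auto simp: m_def algebra_simps)
  also have "\<dots> = m\<^sup>2 * (3 * N + 1)\<^sup>2" by (rule power_mult_distrib)
  also have "\<dots> < m\<^sup>2 * m" by (simp add: m_def)
  also have "\<dots> = m ^ 3" by (simp add: power3_eq_cube power2_eq_square)
  also have "m ^ 3 = card ?E" by (simp add: power3_eq_cube)
  finally have card: "card ?B < card ?E" .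
  have keys: "Poly_Mapping.keys (?\<phi> e) \<subseteq> ?B" if e: "e \<in> ?E" for e
  proof -
    obtain i j l where ijl: "e = (i, j, l)" "i < m" "j < m" "l < m" using e by auto
    have "bd (i * N + (j * N + l * N)) (?\<phi> e)"
      unfolding ijl(1) prod.case by (intro mult power N)
    moreover have "i * N \<le> m * N" "j * N \<le> m * N" "l * N \<le> m * N" using ijl by auto
    ultimately have "bd (3 * m * N) (?\<phi> e)" by (elim mono) linarith
    then show ?thesis by (simp add: bd_def)
  qed
  have "\<exists>c. (\<exists>e\<in>?E. c e \<noteq> 0) \<and> (\<Sum>e\<in>?E. Poly_Mapping.single 0 (c e) * ?\<phi> e) = 0"
    by (rule linear_relation_if_few_keys[OF _ keys card]) simp
  then obtain c where c: "\<exists>e\<in>?E. c e \<noteq> 0" "(\<Sum>e\<in>?E. Poly_Mapping.single 0 (c e) * ?\<phi> e) = 0"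
    by (elim exE conjE)
  show ?thesis
  proof (rule that)
    show "finite {e \<in> ?E. c e \<noteq> 0}" by simp
    show "{e \<in> ?E. c e \<noteq> 0} \<noteq> {}" using c(1) by blast
    show "c e \<noteq> 0" if "e \<in> {e \<in> ?E. c e \<noteq> 0}" for e using that by simp
    have "(\<Sum>(i, j, l)\<in>{e \<in> ?E. c e \<noteq> 0}. f ^ i * (g ^ j * (h ^ l * Poly_Mapping.single 0 (c (i, j, l))))) =
        (\<Sum>e\<in>?E. Poly_Mapping.single 0 (c e) * ?\<phi> e)"
    proof (rule sum.mono_neutral_cong_left)
      show "\<forall>e\<in>?E - {e \<in> ?E. c e \<noteq> 0}. Poly_Mapping.single 0 (c e) * ?\<phi> e = 0" by simp
    qed (auto simp: ac_simps)
    with c(2) show "(\<Sum>(i, j, l)\<in>{e \<in> ?E. c e \<noteq> 0}.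
        f ^ i * (g ^ j * (h ^ l * Poly_Mapping.single 0 (c (i, j, l))))) = 0" by (rule trans[rotated])
  qed
qed

context semigroup_algebra
begin

lemma primeideal_power:
  assumes P: "primeideal P R" and "f \<in> carrier R" "g \<in> carrier R" "f ^ n * g \<in> P" "f \<notin> P"
  shows "g \<in> P"
  using assms(4)
proof (induction n)
  case (Suc n)
  have "f * (f ^ n * g) \<in> P" using Suc(2) by (simp add: ac_simps)
  then have "f ^ n * g \<in> P"
    using primeideal.I_prime[OF P, of f "f ^ n * g"] assms by auto
  then show ?case by (rule Suc(1))
qed simp

text \<open>One step down a relation. Since \<open>f \<notin> P\<close>, the common power \<open>f\<^sup>m\<close> can be cancelled modulo \<open>P\<close>; since
\<open>f \<in> Q\<close>, the terms in which a positive power of \<open>f\<close> remains vanish modulo \<open>Q\<close>.\<close>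

lemma lowest_power_terms_mem:
  assumes P: "primeideal P R" and Q: "ideal Q R" "P \<subseteq> Q" and f: "f \<in> Q" "f \<notin> P"
    and E: "finite E" "\<And>e. e \<in> E \<Longrightarrow> g e \<in> carrier R" "\<And>e. e \<in> E \<Longrightarrow> m \<le> i e"
    and rel: "(\<Sum>e\<in>E. f ^ i e * g e) \<in> P"
  shows "(\<Sum>e | e \<in> E \<and> i e = m. g e) \<in> Q"
proof -
  have fc: "f \<in> carrier R" by (rule ideal_carrier[OF Q(1) f(1)])
  let ?h = "\<lambda>e. f ^ (i e - m) * g e"
  have "f ^ i e * g e = f ^ m * ?h e" if "e \<in> E" for e
    using E(3)[OF that] by (simp add: mult.assoc[symmetric] power_add[symmetric])
  then have "(\<Sum>e\<in>E. f ^ i e * g e) = f ^ m * (\<Sum>e\<in>E. ?h e)"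
    by (simp add: sum_distrib_left)
  moreover have "(\<Sum>e\<in>E. ?h e) \<in> carrier R"
    using E fc by (intro carrier_sum) auto
  ultimately have "(\<Sum>e\<in>E. ?h e) \<in> Q"
    using primeideal_power[OF P fc] rel f(2) Q(2) by auto
  moreover have "(\<Sum>e | e \<in> E \<and> i e \<noteq> m. ?h e) \<in> Q"
  proof (rule ideal_sum[OF Q(1)])
    fix e assume e: "e \<in> {e \<in> E. i e \<noteq> m}"
    then have "i e - m = Suc (i e - Suc m)" using E(3)[of e] by auto
    then have "?h e = (f ^ (i e - Suc m) * g e) * f" by (simp add: ac_simps)
    moreover have "f ^ (i e - Suc m) * g e \<in> carrier R" using e E(2) fc by auto
    ultimately show "?h e \<in> Q"
      using ideal_mult[OF Q(1) f(1)] by metis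
  qed
  moreover have "(\<Sum>e\<in>E. ?h e) = (\<Sum>e | e \<in> E \<and> i e = m. g e) + (\<Sum>e | e \<in> E \<and> i e \<noteq> m. ?h e)"
  proof -
    have "(\<Sum>e\<in>E. ?h e) = (\<Sum>e\<in>E. if i e = m then g e else ?h e)"
      by (intro sum.cong) auto
    then show ?thesis using E(1) by (simp add: sum.If_cases Int_def)
  qed
  ultimately show ?thesis
    using ideal_diff[OF Q(1), of "\<Sum>e\<in>E. ?h e" "\<Sum>e | e \<in> E \<and> i e \<noteq> m. ?h e"] by simp
qed

text \<open>Three steps \<open>P\<^sub>0 \<subset> P\<^sub>1 \<subset> P\<^sub>2 \<subset> P\<^sub>3\<close> would allow to descend in an algebraic relation of \<open>f \<in> P\<^sub>1 - P\<^sub>0\<close>,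
\<open>g \<in> P\<^sub>2 - P\<^sub>1\<close>, \<open>h \<in> P\<^sub>3 - P\<^sub>2\<close> to the coefficient of its lexicographically least monomial, a unit in
\<open>P\<^sub>3\<close>.\<close>

lemma prime_chain_length_le_2:
  assumes "prime_chain R n P"
  shows "n \<le> 2"
proof (rule ccontr)
  assume "\<not> n \<le> 2"
  then have P: "primeideal (P 0) R" "primeideal (P 1) R" "primeideal (P 2) R" "primeideal (P 3) R"
    and "P 0 \<subset> P 1" "P 1 \<subset> P 2" "P 2 \<subset> P 3"
    using assms by (auto simp: prime_chain_def eval_nat_numeral)
  then obtain f g h where fgh: "f \<in> P 1" "f \<notin> P 0" "g \<in> P 2" "g \<notin> P 1" "h \<in> P 3" "h \<notin> P 2"
    and sub: "P 0 \<subseteq> P 1" "P 1 \<subseteq> P 2" "P 2 \<subseteq> P 3" by blast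
  note id = P[THEN primeideal.axioms(1)]
  have car: "f \<in> carrier R" "g \<in> carrier R" "h \<in> carrier R"
    using fgh id ideal_carrier by blast+
  obtain E c where E: "finite E" "E \<noteq> {}" "\<And>e. e \<in> E \<Longrightarrow> c e \<noteq> 0"
    "(\<Sum>(i, j, l)\<in>E. f ^ i * (g ^ j * (h ^ l * Poly_Mapping.single 0 (c (i, j, l))))) = 0"
    by (rule ex_algebraic_relation[of f g h]) (rule that; assumption)
  define m1 where "m1 = Min (fst ` E)"
  define E1 where "E1 = {e \<in> E. fst e = m1}"
  define m2 where "m2 = Min ((fst \<circ> snd) ` E1)"
  define E2 where "E2 = {e \<in> E1. (fst \<circ> snd) e = m2}"
  define m3 where "m3 = Min ((snd \<circ> snd) ` E2)"
  define E3 where "E3 = {e \<in> E2. (snd \<circ> snd) e = m3}"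
  have E1: "finite E1" "E1 \<noteq> {}"
    using minimizers_nonempty[OF E(1,2), of fst] E by (auto simp: E1_def m1_def)
  have E2: "finite E2" "E2 \<noteq> {}"
    using minimizers_nonempty[OF E1, of "fst \<circ> snd"] E1(1) unfolding E2_def m2_def by auto
  have E3: "E3 \<noteq> {}"
    using minimizers_nonempty[OF E2, of "snd \<circ> snd"] unfolding E3_def m3_def .
  let ?c = "\<lambda>e. Poly_Mapping.single 0 (c e)"
  note closed = car carrier_const carrier_mult carrier_power
  have "(\<Sum>e\<in>E1. g ^ (fst \<circ> snd) e * (h ^ (snd \<circ> snd) e * ?c e)) \<in> P 1"
    unfolding E1_def
  proof (rule lowest_power_terms_mem[OF P(1) id(2) sub(1) fgh(1,2) E(1)])
    show "(\<Sum>e\<in>E. f ^ fst e * (g ^ (fst \<circ> snd) e * (h ^ (snd \<circ> snd) e * ?c e))) \<in> P 0"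
      using E(4) ideal_zero[OF id(1)] by (simp add: split_def)
  qed (use E(1) closed in \<open>auto simp: m1_def\<close>)
  then have "(\<Sum>e\<in>E2. h ^ (snd \<circ> snd) e * ?c e) \<in> P 2"
    unfolding E2_def
    by (rule lowest_power_terms_mem[OF P(2) id(3) sub(2) fgh(3,4) E1(1), rotated -1])
      (use E1(1) closed in \<open>auto simp: m2_def\<close>)
  then have "(\<Sum>e\<in>E3. ?c e) \<in> P 3"
    unfolding E3_def
    by (rule lowest_power_terms_mem[OF P(3) id(4) sub(3) fgh(5,6) E2(1), rotated -1])
      (use E2(1) closed in \<open>auto simp: m3_def\<close>)
  moreover have E3_eq: "E3 = {(m1, m2, m3)}"
    using E3 by (force simp: E3_def E2_def E1_def)
  ultimately have "c (m1, m2, m3) = 0"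
    using proper_ideal_const[OF id(4)] primeideal.I_notcarr[OF P(4)] by auto
  moreover have "(m1, m2, m3) \<in> E" using E3_eq by (auto simp: E3_def E2_def E1_def)
  ultimately show False using E(3) by blast
qed

end

section \<open>The Noetherian property\<close>

lemma lookup_single_mult_shift:
  fixes p :: "'a::cancel_comm_monoid_add \<Rightarrow>\<^sub>0 'k::comm_ring_1"
  shows "Poly_Mapping.lookup (Poly_Mapping.single s c * p) (s + t) = c * Poly_Mapping.lookup p t"
  by (simp add: lookup_mult lookup_single when_mult)

context semigroup_algebra
begin

text \<open>Exponents are compared lexicographically. This is a well-order compatible with addition, so
subtracting a multiple of an element of \<open>A\<close> that cancels the leading term makes the leading exponent
smaller, and the division stops.\<close>

lemma noetherian_if_finite_bases:
  assumes basis: "\<And>L. L \<subseteq> S \<Longrightarrow> \<exists>F\<subseteq>L. finite F \<and> (\<forall>l\<in>L. \<exists>f\<in>F. \<exists>s\<in>S. l = s + f)"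
  shows "noetherian_ring R"
proof (rule noetherian_ringI)
  fix I assume I: "ideal I R"
  let ?lm = "\<lambda>p :: (nat \<times> nat) \<Rightarrow>\<^sub>0 'k. Max (Poly_Mapping.keys p)"
  have lm: "?lm p \<in> Poly_Mapping.keys p" if "p \<noteq> 0" for p
    using that by (intro Max_in) auto
  have "?lm ` (I - {0}) \<subseteq> S"
  proof (rule image_subsetI)
    fix p assume "p \<in> I - {0}"
    then show "?lm p \<in> S" using lm[of p] ideal_carrier[OF I, of p] carrier_iff[of p] by blast
  qed
  from basis[OF this] obtain F where F: "F \<subseteq> ?lm ` (I - {0})" "finite F"
    "\<And>l. l \<in> ?lm ` (I - {0}) \<Longrightarrow> \<exists>f\<in>F. \<exists>s\<in>S. l = s + f"
    by metis
  then obtain A where A: "A \<subseteq> I - {0}" "finite A" "F = ?lm ` A"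
    by (meson finite_subset_image)
  have Acar: "A \<subseteq> carrier R" using A(1) ideal_carrier[OF I] by blast
  have IdlA: "ideal (Idl\<^bsub>R\<^esub> A) R" by (rule genideal_ideal[OF Acar])
  have mono: "s + t \<le> s + t'" if "t \<le> t'" for s t t' :: "nat \<times> nat"
    using that by (cases s; cases t; cases t') auto
  have "g \<in> I \<longrightarrow> g \<in> Idl\<^bsub>R\<^esub> A" for g
  proof (induction "?lm g" arbitrary: g rule: less_induct)
    case less
    show ?case
    proof (intro impI, cases "g = 0")
      case True then show "g \<in> Idl\<^bsub>R\<^esub> A" using ideal_zero[OF IdlA] by simp
    next
      case False
      assume g: "g \<in> I"
      obtain p s where ps: "p \<in> A" "s \<in> S" "?lm g = s + ?lm p"
        using F(3)[of "?lm g"] g False A(3) by auto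
      then have p: "p \<in> I" "p \<noteq> 0" using A(1) by auto
      define q where "q = Poly_Mapping.single s (Poly_Mapping.lookup g (?lm g) / Poly_Mapping.lookup p (?lm p)) * p"
      have qA: "q \<in> Idl\<^bsub>R\<^esub> A"
        unfolding q_def using genideal_self[OF Acar] ps
        by (intro ideal_mult[OF IdlA] carrier_single) auto
      have qI: "q \<in> I" unfolding q_def by (intro ideal_mult[OF I p(1)] carrier_single ps(2))
      have "Poly_Mapping.lookup q (?lm g) = Poly_Mapping.lookup g (?lm g)"
        using lm[OF p(2)] unfolding q_def
        by (subst (2) ps(3)) (simp add: lookup_single_mult_shift in_keys_iff)
      then have ne: "?lm g \<notin> Poly_Mapping.keys (g - q)" by (simp add: in_keys_iff lookup_minus)
      have "t \<le> ?lm g" if "t \<in> Poly_Mapping.keys q" for t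
      proof -
        have "t \<in> {a + b | a b. a \<in> Poly_Mapping.keys (Poly_Mapping.single s (Poly_Mapping.lookup g (?lm g) / Poly_Mapping.lookup p (?lm p))) \<and> b \<in> Poly_Mapping.keys p}"
          using that keys_mult unfolding q_def by blast
        then obtain b where "t = s + b" "b \<in> Poly_Mapping.keys p" by (auto split: if_splits)
        then show ?thesis unfolding ps(3) by (auto intro!: mono Max_ge)
      qed
      then have le: "t \<le> ?lm g" if "t \<in> Poly_Mapping.keys (g - q)" for t
        using that keys_diff[of g q] Max_ge[OF finite_keys, of t g] by blast
      have "g - q \<in> Idl\<^bsub>R\<^esub> A"
      proof (cases "g - q = 0")
        case True then show ?thesis using ideal_zero[OF IdlA] by simp
      next
        case False
        then have "?lm (g - q) < ?lm g"
          using lm[OF False] le ne by (metis order_le_imp_less_or_eq)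
        then show ?thesis using less ideal_diff[OF I g qI] by blast
      qed
      from ideal_add[OF IdlA this qA] show "g \<in> Idl\<^bsub>R\<^esub> A" by simp
    qed
  qed
  then have "I = Idl\<^bsub>R\<^esub> A"
    using genideal_minimal[OF I, of A] A(1) by blast
  then show "\<exists>A\<subseteq>carrier R. finite A \<and> I = Idl\<^bsub>R\<^esub> A" using Acar A(2) by blast
qed

end

section \<open>Polynomials with polynomial coefficients\<close>

text \<open>The polynomial \<open>1 + X c\<close> is coprime to \<open>c\<close> and has positive degree.\<close>

lemma not_dvd_power_of_coprime:
  fixes p c :: "'k::field poly"
  assumes "p = pCons 1 c" "c \<noteq> 0"
  shows "\<not> p dvd c ^ n"
proof (induction n)
  case 0
  show ?case using assms by (auto simp: is_unit_iff_degree)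
next
  case (Suc n)
  have "c ^ n = p * c ^ n - [:0, 1:] * c ^ Suc n"
    by (simp add: assms(1) algebra_simps)
  then show ?case using Suc by (metis dvd_diff dvd_triv_left dvd_mult)
qed

text \<open>Zariski's lemma in two variables: if \<open>K[X][W]/M\<close> is a field, then \<open>X\<close> is algebraic over \<open>K\<close> in it.
Otherwise \<open>K[X]\<close> embeds into the field. An element \<open>G\<close> of \<open>M\<close> of least degree \<open>D\<close> in \<open>W\<close>, with leading
coefficient \<open>c\<close>, makes \<open>1, W, \<dots>, W\<^bsup>D-1\<^esup>\<close> independent over \<open>K[X]\<close> and spanning after inverting
\<open>c\<close>. Expanding the inverse of an element \<open>p \<in> K[X]\<close> in this basis gives \<open>c\<^sup>n = p b\<^sub>0\<close>, where \<open>b\<^sub>0 \<in> K[X]\<close>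
is the coefficient of \<open>1\<close>. For \<open>p = 1 + X c\<close> this is impossible. If
\<open>M = 0\<close>, then \<open>X\<close> has no inverse.\<close>

lemma maximal_ideal_contains_constant_poly:
  fixes M :: "'k::field poly poly set"
  assumes zero: "0 \<in> M" and diff: "\<And>F G. F \<in> M \<Longrightarrow> G \<in> M \<Longrightarrow> F - G \<in> M"
    and mult: "\<And>F G. F \<in> M \<Longrightarrow> G * F \<in> M"
    and inv: "\<And>F. F \<notin> M \<Longrightarrow> \<exists>G. F * G - 1 \<in> M"
  shows "\<exists>p. p \<noteq> 0 \<and> [:p:] \<in> M"
proof (rule ccontr)
  assume "\<not> ?thesis"
  then have const: "[:p:] \<notin> M" if "p \<noteq> 0" for p using that by blast
  show False
  proof (cases "M = {0}")
    case True
    obtain G where "[:[:0, 1:]:] * G - 1 \<in> M" using inv[OF const[of "[:0, 1:]"]] by auto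
    then have "[:[:0, 1 :: 'k:]:] * G = 1" using True by simp
    then have "[:[:0, 1 :: 'k:]:] dvd 1" by (metis dvd_triv_left)
    then have "[:0, 1 :: 'k:] dvd coeff 1 0" unfolding const_poly_dvd_iff by (rule spec)
    then show False by (simp add: is_unit_iff_degree)
  next
    case False
    define D where "D = (LEAST D. \<exists>G\<in>M. G \<noteq> 0 \<and> degree G = D)"
    have "\<exists>D. \<exists>G\<in>M. G \<noteq> 0 \<and> degree G = D" using False zero by blast
    then have "\<exists>G\<in>M. G \<noteq> 0 \<and> degree G = D" unfolding D_def by (rule LeastI_ex)
    then obtain G where G: "G \<in> M" "G \<noteq> 0" "degree G = D" by blast
    have small: "F = 0" if "F \<in> M" "degree F < D" for F
      using that not_less_Least[of "degree F"] unfolding D_def by blast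
    have D: "D > 0"
    proof (rule ccontr)
      assume "\<not> D > 0"
      then obtain c where "G = [:c:]" using G(3) degree_eq_zeroE by blast
      then show False using const[of c] G by auto
    qed
    define c where "c = lead_coeff G"
    have c: "c \<noteq> 0" using G(2) by (simp add: c_def)
    \<comment> \<open>the polynomial \<open>1 + X c\<close>\<close>
    define p where "p = pCons 1 c"
    obtain H where H: "[:p:] * H - 1 \<in> M" using inv[OF const[of p]] by (auto simp: p_def)
    obtain Q r where Qr: "pseudo_divmod H G = (Q, r)" by (cases "pseudo_divmod H G")
    define n where "n = Suc (degree H) - degree G"
    have div: "smult (c ^ n) H = G * Q + r"
      using pseudo_divmod(1)[OF G(2) Qr] by (simp add: c_def n_def)
    have deg: "degree r < D" using pseudo_divmod(2)[OF G(2) Qr] G(3) D by auto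
    have ring: "P * (C * H - G * Q) - C = C * (P * H - 1) - (P * Q) * G" for P C :: "'k poly poly"
      by (simp add: algebra_simps)
    have "r = [:c ^ n:] * H - G * Q" using div by simp
    then have "[:p:] * r - [:c ^ n:] = [:c ^ n:] * ([:p:] * H - 1) - ([:p:] * Q) * G"
      using ring by metis
    then have "[:p:] * r - [:c ^ n:] \<in> M" using diff mult H G(1) by metis
    moreover have "degree ([:p:] * r - [:c ^ n:]) < D"
      using deg D by (intro degree_diff_less) (auto intro: le_less_trans[OF degree_smult_le])
    ultimately have "[:p:] * r = [:c ^ n:]" using small by fastforce
    then have "coeff ([:p:] * r) 0 = c ^ n" by simp
    then have "p * coeff r 0 = c ^ n" by simp
    then have "p dvd c ^ n" by (metis dvd_triv_left)
    then show False using not_dvd_power_of_coprime[OF p_def c] by blast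
  qed
qed

text \<open>The topmost coefficient of \<open>F\<close> that \<open>p\<close> does not divide meets the unit \<open>lead_coeff Q\<close> in a coefficient
of \<open>Q * F\<close>, all of whose other summands are divisible by \<open>p\<close>.\<close>

lemma const_poly_dvd_cancel:
  fixes p :: "'a::idom" and F Q :: "'a poly"
  assumes "[:p:] dvd Q * F" "lead_coeff Q dvd 1"
  shows "[:p:] dvd F"
proof (rule ccontr)
  assume "\<not> ?thesis"
  then have ex: "\<exists>n. \<not> p dvd coeff F n" by (simp add: const_poly_dvd_iff)
  have bound: "n \<le> degree F" if "\<not> p dvd coeff F n" for n
    using that by (auto intro: le_degree)
  define n where "n = (GREATEST n. \<not> p dvd coeff F n)"
  have n: "\<not> p dvd coeff F n"
    unfolding n_def by (rule GreatestI_ex_nat[OF ex bound])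
  have above: "p dvd coeff F i" if "n < i" for i
    using that Greatest_le_nat[of "\<lambda>n. \<not> p dvd coeff F n" i, OF _ bound] unfolding n_def by fastforce
  let ?D = "degree Q"
  have "coeff (Q * F) (?D + n) = (\<Sum>i\<le>?D + n. coeff Q i * coeff F (?D + n - i))"
    by (rule coeff_mult)
  also have "\<dots> = coeff Q ?D * coeff F n + (\<Sum>i\<in>{..?D + n} - {?D}. coeff Q i * coeff F (?D + n - i))"
    by (subst sum.remove[of _ ?D]) auto
  finally have eq: "coeff (Q * F) (?D + n) = \<dots>" .
  have "p dvd (\<Sum>i\<in>{..?D + n} - {?D}. coeff Q i * coeff F (?D + n - i))"
  proof (rule dvd_sum)
    fix i assume i: "i \<in> {..?D + n} - {?D}"
    show "p dvd coeff Q i * coeff F (?D + n - i)"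
    proof (cases "i < ?D")
      case True then show ?thesis by (intro dvd_mult above) simp
    next
      case False then show ?thesis using i by (simp add: coeff_eq_0)
    qed
  qed
  moreover have "p dvd coeff (Q * F) (?D + n)" using assms(1) by (simp add: const_poly_dvd_iff)
  ultimately have "p dvd coeff Q ?D * coeff F n" unfolding eq using dvd_add_left_iff by blast
  moreover obtain u where "1 = coeff Q ?D * u" using assms(2) by (rule dvdE)
  then have "coeff F n = u * (coeff Q ?D * coeff F n)" by (metis mult.assoc mult.commute mult_1)
  ultimately have "p dvd coeff F n" by (metis dvd_mult)
  then show False using n by blast
qed

definition eval_poly :: "('a::comm_ring_1 \<Rightarrow> 'b::comm_ring_1) \<Rightarrow> 'a poly \<Rightarrow> 'b \<Rightarrow> 'b" where
  "eval_poly g p z = poly (map_poly g p) z"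

locale class_ring_hom =
  fixes g :: "'a::comm_ring_1 \<Rightarrow> 'b::comm_ring_1"
  assumes hom_add: "g (x + y) = g x + g y" and hom_mult: "g (x * y) = g x * g y"
    and hom_one: "g 1 = 1"
begin

lemma hom_zero: "g 0 = 0"
  using hom_add[of 0 0] by simp

lemma eval_zero [simp]: "eval_poly g 0 z = 0"
  by (simp add: eval_poly_def)

lemma eval_pCons: "eval_poly g (pCons c p) z = g c + z * eval_poly g p z"
  by (simp add: eval_poly_def map_poly_pCons hom_zero)

lemma eval_add: "eval_poly g (p + q) z = eval_poly g p z + eval_poly g q z"
  by (induction p q rule: poly_induct2) (simp_all add: eval_pCons hom_add algebra_simps)

lemma eval_smult: "eval_poly g (smult c p) z = g c * eval_poly g p z"
  by (induction p) (simp_all add: eval_pCons hom_mult algebra_simps)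

lemma eval_mult: "eval_poly g (p * q) z = eval_poly g p z * eval_poly g q z"
  by (induction p) (simp_all add: eval_pCons eval_add eval_smult hom_zero algebra_simps)

lemma eval_monom: "eval_poly g (monom c n) z = g c * z ^ n"
  by (induction n) (simp_all add: monom_0 monom_Suc eval_pCons hom_zero)

lemma class_ring_hom_eval: "class_ring_hom (\<lambda>p. eval_poly g p z)"
  by unfold_locales (simp_all add: eval_add eval_mult one_pCons eval_pCons hom_one)

text \<open>A polynomial serves as the list of coefficients of a linear combination of the family \<open>v\<close>. For
\<open>v j = z ^ j\<close> this is \<open>eval_poly g F z\<close>; the families used below are not of this form.\<close>

definition combination :: "(nat \<Rightarrow> 'b) \<Rightarrow> 'a poly \<Rightarrow> 'b" where
  "combination v F = (\<Sum>j\<le>degree F. g (coeff F j) * v j)"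

lemma combination_zero [simp]: "combination v 0 = 0"
  by (simp add: combination_def hom_zero)

lemma combination_pCons:
  "combination v (pCons p F) = g p * v 0 + combination (\<lambda>j. v (Suc j)) F"
  by (cases "F = 0") (simp_all add: combination_def sum.atMost_Suc_shift hom_zero del: sum.atMost_Suc)

lemma combination_add: "combination v (F + G) = combination v F + combination v G"
  by (induction F G arbitrary: v rule: poly_induct2)
    (simp_all add: combination_pCons hom_add algebra_simps)

lemma combination_smult: "combination v (smult p F) = g p * combination v F"
  by (induction F arbitrary: v) (simp_all add: combination_pCons hom_mult algebra_simps)

lemma combination_scale: "combination (\<lambda>j. y * v j) F = y * combination v F"
  by (simp add: combination_def sum_distrib_left ac_simps)

lemma combination_monom_mult:
  "combination v (monom 1 k * F) = combination (\<lambda>j. v (j + k)) F"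
proof (induction k arbitrary: v)
  case (Suc k)
  have "combination v (monom 1 (Suc k) * F) = combination (\<lambda>j. v (Suc j)) (monom 1 k * F)"
    by (simp add: monom_Suc combination_pCons hom_zero)
  with Suc show ?case by simp
qed (simp add: monom_0)

lemma combination_monom: "combination v (monom p j) = g p * v j"
  by (induction j arbitrary: v) (simp_all add: monom_0 monom_Suc combination_pCons hom_zero)

text \<open>If \<open>y\<close> shifts the family \<open>v\<close> by \<open>k\<close> places, it acts on linear combinations as \<open>W\<^sup>k\<close>, and hence a
polynomial \<open>r(y)\<close> acts as \<open>r(W\<^sup>k)\<close>.\<close>

lemma combination_pcompose_monom_mult:
  assumes shift: "\<And>j. v (j + k) = y * v j"
  shows "combination v (pcompose r (monom 1 k) * F) = eval_poly g r y * combination v F"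
proof (induction r)
  case (pCons c r)
  have "combination v (monom 1 k * (pcompose r (monom 1 k) * F)) = y * combination v (pcompose r (monom 1 k) * F)"
    by (simp add: combination_monom_mult shift combination_scale)
  with pCons show ?case
    by (simp add: pcompose_pCons eval_pCons combination_add combination_smult algebra_simps)
qed simp

end

section \<open>Maximal ideals of a semigroup ring\<close>

abbreviation const_term :: "'k::field \<Rightarrow> (nat \<times> nat) \<Rightarrow>\<^sub>0 'k" where
  "const_term c \<equiv> Poly_Mapping.single 0 c"

abbreviation eval_at_monomial :: "nat \<times> nat \<Rightarrow> 'k::field poly \<Rightarrow> (nat \<times> nat) \<Rightarrow>\<^sub>0 'k" where
  "eval_at_monomial e p \<equiv> eval_poly const_term p (Poly_Mapping.single e 1)"

interpretation const_term: class_ring_hom "const_term :: 'k::field \<Rightarrow> _"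
  by unfold_locales (simp_all add: single_add mult_single)

interpretation eval_at_monomial: class_ring_hom "eval_at_monomial e :: 'k::field poly \<Rightarrow> _" for e
  by (rule const_term.class_ring_hom_eval)

lemma nscale_simps [simp]: "nscale 0 v = 0" "nscale (Suc n) v = v + nscale n v" "nscale 1 v = v"
  by (simp_all add: nscale_def prod_eq_iff)

lemma nscale_add: "nscale (m + n) v = nscale m v + nscale n v"
  by (simp add: nscale_def prod_eq_iff algebra_simps)

lemma single_power: "Poly_Mapping.single e (1 :: 'k::field) ^ n = Poly_Mapping.single (nscale n e) 1"
  by (induction n) (simp_all add: mult_single)

lemma eval_at_monomial_sum:
  "eval_at_monomial e p = (\<Sum>i\<le>degree p. Poly_Mapping.single (nscale i e) (coeff p i))"
proof -
  have "degree (map_poly const_term p) = degree p"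
    by (intro degree_map_poly) (metis lookup_single_eq lookup_zero)
  then show ?thesis
    by (simp add: eval_poly_def poly_altdef coeff_map_poly single_power mult_single)
qed

context semigroup_algebra
begin

lemma carrier_induct [consumes 1, case_names zero add single]:
  assumes "p \<in> carrier R"
    and "P 0"
    and add: "\<And>p q. P p \<Longrightarrow> P q \<Longrightarrow> P (p + q)"
    and single: "\<And>s c. s \<in> S \<Longrightarrow> P (Poly_Mapping.single s c)"
  shows "P p"
proof -
  have "P (\<Sum>s\<in>A. Poly_Mapping.single s (c s))" if "A \<subseteq> S" "finite A" for A c
    using that(2,1) by (induction rule: finite_induct) (auto intro: assms)
  moreover have "p \<in> {\<Sum>s\<in>A. Poly_Mapping.single s (c s) | A c. finite A \<and> A \<subseteq> S}"
    using assms(1) unfolding semigroup_ring_span[symmetric] by (simp add: semigroup_ring_def)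
  ultimately show ?thesis by auto
qed

lemma carrier_eval:
  assumes "e \<in> S"
  shows "eval_at_monomial e p \<in> carrier R"
  by (induction p)
    (auto simp: const_term.eval_pCons intro!: carrier_add carrier_mult carrier_const carrier_single assms)

lemma maximalideal_inverse:
  assumes m: "maximalideal m R" and x: "x \<in> carrier R" "x \<notin> m"
  obtains u where "u \<in> carrier R" "x * u - 1 \<in> m"
proof -
  interpret m: maximalideal m R by fact
  obtain J where J: "ideal J R" "m \<subseteq> J" "x \<in> J"
    "\<And>y. y \<in> J \<Longrightarrow> \<exists>i\<in>m. \<exists>r\<in>carrier R. y = i \<oplus>\<^bsub>R\<^esub> r \<otimes>\<^bsub>R\<^esub> x"
    by (rule ideal_adjoin[OF m.is_ideal x(1)]) (rule that; assumption)
  have "J = carrier R"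
    using m.I_maximal[OF J(1,2)] J(3) x(2) ideal_carrier[OF J(1)] by blast
  then obtain i r where ir: "i \<in> m" "r \<in> carrier R" "1 = i + r * x"
    using J(4)[of 1] by auto
  then have "x * r - 1 = 0 - i" by (simp add: algebra_simps)
  also have "\<dots> \<in> m" by (intro ideal_diff ideal_zero m.is_ideal ir)
  finally show ?thesis using that ir(2) by blast
qed

text \<open>The hypothesis \<open>gen\<close> says that \<open>t\<^sup>s = X\<^sup>n (t\<^bsup>e1\<^esup> / X)\<^sup>j\<close> with \<open>X = t\<^sup>e\<close>. So if \<open>X \<notin> m\<close>, then
the field \<open>R/m\<close> is generated over \<open>K\<close> by \<open>X\<close> and \<open>w = t\<^bsup>e1\<^esup> / X\<close>, and Zariski's lemma in two variables
applies to the preimage of \<open>m\<close> in \<open>K[X][W]\<close>.\<close>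

lemma maximal_ideal_contains_poly_in_monomial:
  assumes m: "maximalideal m R" and e: "e \<in> S" "e1 \<in> S"
    and gen: "\<And>s. s \<in> S \<Longrightarrow> \<exists>n j. s + nscale j e = nscale n e + nscale j e1"
  shows "\<exists>p. p \<noteq> 0 \<and> eval_at_monomial e p \<in> m"
proof -
  interpret m: maximalideal m R by fact
  have I: "ideal m R" by (rule m.is_ideal)
  let ?X = "Poly_Mapping.single e 1 :: (nat \<times> nat) \<Rightarrow>\<^sub>0 'k"
  have X: "?X \<in> carrier R" by (rule carrier_single[OF e(1)])
  show ?thesis
  proof (cases "?X \<in> m")
    case True
    then show ?thesis
      by (intro exI[of _ "[:0, 1:]"]) (simp add: const_term.eval_pCons)
  next
    case False
    obtain u where u: "u \<in> carrier R" "?X * u - 1 \<in> m"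
      by (rule maximalideal_inverse[OF m X False])
    define w where "w = u * Poly_Mapping.single e1 1"
    have w: "w \<in> carrier R" unfolding w_def by (intro carrier_mult u carrier_single e)
    let ?ev = "\<lambda>F. eval_poly (eval_at_monomial e) F w"
    interpret ev: class_ring_hom ?ev by (rule eval_at_monomial.class_ring_hom_eval)
    have ev_carrier: "?ev F \<in> carrier R" for F
      by (induction F)
        (auto simp: eval_at_monomial.eval_pCons intro!: carrier_add carrier_mult carrier_eval w e)
    have ev_diff: "?ev (F - G) = ?ev F - ?ev G" for F G
      using ev.hom_add[of "F - G" G] by simp
    have power: "(?X * u) ^ j - 1 \<in> m" for j
    proof (induction j)
      case (Suc j)
      have step: "(?X * u) ^ Suc j - 1 = (?X * u) * ((?X * u) ^ j - 1) + (?X * u - 1)"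
        by (simp add: algebra_simps)
      show ?case
        unfolding step by (intro ideal_add[OF I] ideal_mult[OF I] carrier_mult Suc u X)
    qed (simp add: ideal_zero[OF I])
    have onto: "\<exists>F. ?ev F - r \<in> m" if "r \<in> carrier R" for r
      using that
    proof (induction r rule: carrier_induct)
      case zero
      show ?case by (intro exI[of _ 0]) (simp add: ideal_zero[OF I] ev.hom_zero)
    next
      case (add p q)
      then obtain F G where "?ev F - p \<in> m" "?ev G - q \<in> m" by blast
      from ideal_add[OF I this] show ?case
        by (intro exI[of _ "F + G"]) (simp add: ev.hom_add algebra_simps)
    next
      case (single s c)
      obtain n j where nj: "s + nscale j e = nscale n e + nscale j e1" using gen[OF single] by blast
      have "?ev (monom (monom c n) j) = const_term c * (?X ^ n * Poly_Mapping.single e1 1 ^ j) * u ^ j"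
        by (simp add: eval_at_monomial.eval_monom const_term.eval_monom w_def power_mult_distrib ac_simps)
      also have "?X ^ n * Poly_Mapping.single e1 1 ^ j = Poly_Mapping.single s 1 * ?X ^ j"
        by (simp add: single_power mult_single nj)
      also have "const_term c * (Poly_Mapping.single s 1 * ?X ^ j) * u ^ j =
          (const_term c * Poly_Mapping.single s 1) * (?X * u) ^ j"
        by (simp add: power_mult_distrib ac_simps)
      also have "const_term c * Poly_Mapping.single s 1 = Poly_Mapping.single s c"
        by (simp add: mult_single)
      finally have "?ev (monom (monom c n) j) - Poly_Mapping.single s c =
          Poly_Mapping.single s c * ((?X * u) ^ j - 1)"
        by (simp add: algebra_simps)
      then show ?case
        using ideal_mult[OF I power carrier_single[OF single]] by metis
    qed
    have "\<exists>p. p \<noteq> 0 \<and> [:p:] \<in> {F. ?ev F \<in> m}"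
    proof (rule maximal_ideal_contains_constant_poly)
      show "0 \<in> {F. ?ev F \<in> m}" by (simp add: ideal_zero[OF I] ev.hom_zero)
    next
      fix F G assume "F \<in> {F. ?ev F \<in> m}" "G \<in> {F. ?ev F \<in> m}"
      then show "F - G \<in> {F. ?ev F \<in> m}" by (simp add: ev_diff ideal_diff[OF I])
    next
      fix F G assume "F \<in> {F. ?ev F \<in> m}"
      then show "G * F \<in> {F. ?ev F \<in> m}" by (simp add: ev.hom_mult ideal_mult[OF I] ev_carrier)
    next
      fix F assume "F \<notin> {F. ?ev F \<in> m}"
      then obtain r where r: "r \<in> carrier R" "?ev F * r - 1 \<in> m"
        using maximalideal_inverse[OF m ev_carrier] by blast
      obtain G where G: "?ev G - r \<in> m" using onto[OF r(1)] by blast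
      have "?ev (F * G - 1) = ?ev F * (?ev G - r) + (?ev F * r - 1)"
        by (simp add: ev_diff ev.hom_mult ev.hom_one algebra_simps)
      also have "\<dots> \<in> m" by (intro ideal_add[OF I] ideal_mult[OF I] G r ev_carrier)
      finally show "\<exists>G. F * G - 1 \<in> {F. ?ev F \<in> m}" by blast
    qed
    then show ?thesis by (simp add: eval_at_monomial.eval_pCons)
  qed
qed

end

section \<open>Free modules over the ring of polynomials in one monomial\<close>

context semigroup_algebra
begin

text \<open>The hypotheses say that the monomials \<open>t\<^bsup>b j\<^esup>\<close> form a basis of \<open>R\<close> over \<open>K[x]\<close>, where \<open>x = t\<^sup>e\<close>, and that
\<open>y = t\<^bsup>e'\<^esup>\<close> maps the \<open>j\<close>-th basis element to the \<open>(j + k)\<close>-th. The bijection \<open>\<Lambda>\<close> from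
\<open>K[x][W]\<close> to \<open>R\<close> with \<open>\<Lambda>(W\<^sup>j) = t\<^bsup>b j\<^esup>\<close> is not multiplicative, but it is linear over
\<open>K[x]\<close> and turns \<open>W\<^sup>k\<close> into \<open>y\<close>, which suffices to compare divisibility by \<open>p(x)\<close> on both sides.\<close>

lemma regular_sequence_if_free:
  fixes b :: "nat \<Rightarrow> nat \<times> nat"
  assumes e: "e \<in> S" "e' \<in> S" and b: "\<And>j. b j \<in> S"
    and inj: "\<And>n j n' j'. nscale n e + b j = nscale n' e + b j' \<Longrightarrow> n = n' \<and> j = j'"
    and onto: "\<And>s. s \<in> S \<Longrightarrow> \<exists>n j. s = nscale n e + b j"
    and shift: "\<And>j. b (j + k) = b j + e'" and "k > 0"
    and p: "p \<noteq> 0" and q: "q \<noteq> 0"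
    and I: "ideal I R" "I \<noteq> carrier R" "eval_at_monomial e p \<in> I" "eval_at_monomial e' q \<in> I"
  shows "regular_sequence R [eval_at_monomial e p, eval_at_monomial e' q]"
proof -
  let ?P = "eval_at_monomial e p :: _ \<Rightarrow>\<^sub>0 'k" and ?Q = "eval_at_monomial e' q :: _ \<Rightarrow>\<^sub>0 'k"
  let ?v = "\<lambda>j. Poly_Mapping.single (b j) (1 :: 'k)"
  define \<Lambda> where "\<Lambda> = eval_at_monomial.combination e ?v"
  have car: "?P \<in> carrier R" "?Q \<in> carrier R" by (intro carrier_eval e)+
  have \<Lambda>_sum: "\<Lambda> F = (\<Sum>j\<le>degree F. eval_at_monomial e (coeff F j) * ?v j)" for F
    unfolding \<Lambda>_def eval_at_monomial.combination_def ..
  have \<Lambda>_carrier: "\<Lambda> F \<in> carrier R" for F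
    unfolding \<Lambda>_sum
    by (intro carrier_sum carrier_mult carrier_eval carrier_single e b)
  have lookup: "Poly_Mapping.lookup (\<Lambda> F) (nscale n e + b j) = coeff (coeff F j) n" for F n j
  proof -
    have eq: "nscale i e + b l = nscale n e + b j \<longleftrightarrow> i = n \<and> l = j" for i l
      using inj by blast
    have "Poly_Mapping.lookup (\<Lambda> F) (nscale n e + b j) =
      (\<Sum>l\<le>degree F. \<Sum>i\<le>degree (coeff F l). if i = n \<and> l = j then coeff (coeff F l) i else 0)"
      unfolding \<Lambda>_sum eval_at_monomial_sum
      by (simp add: sum_distrib_right mult_single lookup_sum lookup_single when_def eq)
    also have "\<dots> = (\<Sum>l\<le>degree F. if l = j then coeff (coeff F j) n else 0)"
      by (intro sum.cong refl) (auto simp: coeff_eq_0)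
    also have "\<dots> = coeff (coeff F j) n"
      by (auto simp: coeff_eq_0)
    finally show ?thesis .
  qed
  have \<Lambda>_inj: "F = G" if "\<Lambda> F = \<Lambda> G" for F G
    by (intro poly_eqI) (metis that lookup)
  have \<Lambda>_onto: "\<exists>F. r = \<Lambda> F" if "r \<in> carrier R" for r
    using that
  proof (induction r rule: carrier_induct)
    case zero
    show ?case by (intro exI[of _ 0]) (simp add: \<Lambda>_def)
  next
    case (add r r')
    then show ?case by (metis \<Lambda>_def eval_at_monomial.combination_add)
  next
    case (single s c)
    obtain n j where "s = nscale n e + b j" using onto[OF single] by blast
    then show ?case
      by (intro exI[of _ "monom (monom c n) j"])
        (simp add: \<Lambda>_def eval_at_monomial.combination_monom const_term.eval_monom single_power mult_single)
  qed
  have \<Lambda>_P: "\<Lambda> (smult p F) = ?P * \<Lambda> F" for F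
    by (simp add: \<Lambda>_def eval_at_monomial.combination_smult)
  define q' where "q' = pcompose (map_poly (\<lambda>c. [:c:]) q) (monom 1 k)"
  have \<Lambda>_Q: "\<Lambda> (q' * F) = ?Q * \<Lambda> F" for F
  proof -
    have "eval_poly (eval_at_monomial e) (map_poly (\<lambda>c. [:c:]) q) (Poly_Mapping.single e' 1) = ?Q"
      unfolding eval_poly_def[of "eval_at_monomial e"] eval_poly_def[of const_term q]
      by (simp add: map_poly_map_poly o_def eval_at_monomial.hom_zero const_term.eval_pCons)
    then show ?thesis
      unfolding \<Lambda>_def q'_def
      by (subst eval_at_monomial.combination_pcompose_monom_mult[where y = "Poly_Mapping.single e' 1"])
        (simp_all add: shift mult_single add.commute)
  qed
  have "lead_coeff q' = lead_coeff (map_poly (\<lambda>c. [:c:]) q)"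
    using \<open>k > 0\<close> unfolding q'_def by (subst lead_coeff_comp) (simp_all add: degree_monom_eq)
  also have "\<dots> = [:lead_coeff q:]"
    by (simp add: coeff_map_poly degree_map_poly)
  also have "\<dots> dvd 1"
    using q by (simp add: is_unit_const_poly_iff dvd_field_iff)
  finally have unit: "lead_coeff q' dvd 1" .
  have Idl1: "Idl\<^bsub>R\<^esub> {?P} = {r * ?P | r. r \<in> carrier R}"
    using cgenideal_eq_genideal[OF car(1)] by (simp add: cgenideal_def)
  have Idl0: "Idl\<^bsub>R\<^esub> {} = {0}"
    using genideal_zero genideal_minimal[OF zeroideal, of "{}"] ideal_zero[OF genideal_ideal, of "{}"]
    by auto
  have \<Lambda>_0: "\<Lambda> 0 = 0" by (simp add: \<Lambda>_def)
  have reg1: "r = 0" if r: "r \<in> carrier R" "?P * r = 0" for r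
  proof -
    obtain F where F: "r = \<Lambda> F" using \<Lambda>_onto[OF r(1)] by blast
    have "\<Lambda> (smult p F) = \<Lambda> 0" using r(2) unfolding F \<Lambda>_P \<Lambda>_0 .
    then have "smult p F = 0" by (rule \<Lambda>_inj)
    then have "F = 0" using p by simp
    then show ?thesis unfolding F by (simp only: \<Lambda>_0)
  qed
  have reg2: "r \<in> Idl\<^bsub>R\<^esub> {?P}" if r: "r \<in> carrier R" "?Q * r \<in> Idl\<^bsub>R\<^esub> {?P}" for r
  proof -
    obtain r' where r': "r' \<in> carrier R" "?Q * r = r' * ?P" using r(2) Idl1 by auto
    obtain F G where FG: "r = \<Lambda> F" "r' = \<Lambda> G" using \<Lambda>_onto r(1) r'(1) by metis
    have "\<Lambda> (q' * F) = \<Lambda> (smult p G)"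
      using r'(2) unfolding FG \<Lambda>_P \<Lambda>_Q by (simp only: mult.commute)
    then have "q' * F = [:p:] * G" using \<Lambda>_inj by fastforce
    then have "[:p:] dvd q' * F" by (metis dvd_triv_left)
    then have "[:p:] dvd F" using unit by (rule const_poly_dvd_cancel)
    then obtain H where "F = smult p H" by (auto elim: dvdE)
    then have "r = \<Lambda> H * ?P" unfolding FG by (simp only: \<Lambda>_P mult.commute)
    then show ?thesis unfolding Idl1 using \<Lambda>_carrier by blast
  qed
  have "Idl\<^bsub>R\<^esub> {?P, ?Q} \<subseteq> I" using I by (intro genideal_minimal) auto
  then have proper: "Idl\<^bsub>R\<^esub> {?P, ?Q} \<noteq> carrier R"
    using I(2) ideal_carrier[OF I(1)] by blast
  show ?thesis
    unfolding regular_sequence_def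
    using car reg1 reg2 proper by (auto simp: less_Suc_eq Idl0)
qed

end

section \<open>The semigroup of an arithmetic sequence\<close>

text \<open>Take a point \<open>(a0, b0)\<close> with the least second coordinate. It lies below all points with \<open>a0 \<le> x\<close>; each of the
finitely many remaining columns is covered by its own least point.\<close>

lemma dickson_nat_pairs:
  fixes L :: "(nat \<times> nat) set"
  shows "\<exists>F\<subseteq>L. finite F \<and> (\<forall>(x, y)\<in>L. \<exists>(x', y')\<in>F. x' \<le> x \<and> y' \<le> y)"
proof (cases "L = {}")
  case False
  define b0 where "b0 = (LEAST y. \<exists>x. (x, y) \<in> L)"
  have "\<exists>y x. (x, y) \<in> L" using False by auto
  then have "\<exists>x. (x, b0) \<in> L" unfolding b0_def by (rule LeastI_ex)
  then obtain a0 where a0: "(a0, b0) \<in> L" by blast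
  have b0: "b0 \<le> y" if "(x, y) \<in> L" for x y
    unfolding b0_def by (rule Least_le) (use that in blast)
  define m where "m x = (LEAST y. (x, y) \<in> L)" for x
  have m: "(x, m x) \<in> L" "m x \<le> y" if "(x, y) \<in> L" for x y
    unfolding m_def using that by (auto intro: LeastI Least_le)
  let ?F = "insert (a0, b0) ((\<lambda>x. (x, m x)) ` {x \<in> {..<a0}. (x, m x) \<in> L})"
  have "\<exists>(x', y')\<in>?F. x' \<le> x \<and> y' \<le> y" if "(x, y) \<in> L" for x y
  proof (cases "a0 \<le> x")
    case True then show ?thesis using b0[OF that] by auto
  next
    case False then show ?thesis using m[OF that] by (intro bexI[of _ "(x, m x)"]) auto
  qed
  then show ?thesis using a0 by (intro exI[of _ ?F]) auto
qed simp

definition nat_comb :: "nat \<times> nat \<Rightarrow> nat \<times> nat \<Rightarrow> nat \<Rightarrow> nat \<Rightarrow> nat \<times> nat" where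
  "nat_comb a d n j = nscale n a + nscale j d"

lemma nat_comb_add: "nat_comb a d n j + nat_comb a d n' j' = nat_comb a d (n + n') (j + j')"
  by (simp add: nat_comb_def nscale_add ac_simps)

lemma nscale_nat_comb: "nscale m (nat_comb a d n j) = nat_comb a d (m * n) (m * j)"
  by (simp add: nat_comb_def nscale_def algebra_simps)

lemma nat_comb_0 [simp]: "nat_comb a d 0 0 = 0"
  by (simp add: nat_comb_def)

lemma nat_comb_sum: "(\<Sum>x\<in>A. nat_comb a d (f x) (g x)) = nat_comb a d (sum f A) (sum g A)"
  by (induction A rule: infinite_finite_induct) (simp_all add: nat_comb_add)

lemma nat_comb_inj:
  assumes "lin_indep_rat a d" "nat_comb a d n j = nat_comb a d n' j'"
  shows "n = n' \<and> j = j'"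
proof -
  have *: "n * fst a + j * fst d = n' * fst a + j' * fst d"
    "n * snd a + j * snd d = n' * snd a + j' * snd d"
    using assms(2) by (auto simp: nat_comb_def nscale_def)
  then have "(of_nat n - of_nat n') * of_nat (fst a) + (of_nat j - of_nat j') * of_nat (fst d) = (0 :: rat)"
    "(of_nat n - of_nat n') * of_nat (snd a) + (of_nat j - of_nat j') * of_nat (snd d) = (0 :: rat)"
    by (simp_all add: algebra_simps flip: of_nat_mult of_nat_add)
  then have "of_nat n - of_nat n' = (0 :: rat) \<and> of_nat j - of_nat j' = (0 :: rat)"
    using assms(1) unfolding lin_indep_rat_def by blast
  then show ?thesis by simp
qed

lemma semigroup_gen_generator:
  assumes "finite A" "x \<in> A"
  shows "x \<in> semigroup_gen A"
proof -
  have "(\<Sum>y\<in>A. nscale (if y = x then 1 else 0) y) = (\<Sum>y\<in>A. if y = x then x else 0)"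
    by (intro sum.cong) auto
  also have "\<dots> = x" using assms by simp
  finally have eq: "(\<Sum>y\<in>A. nscale (if y = x then 1 else 0) y) = x" .
  show ?thesis
    unfolding semigroup_gen_def mem_Collect_eq
    by (rule exI[of _ "\<lambda>y. if y = x then 1 else 0"]) (simp only: eq simp_thms)
qed

text \<open>A sum of \<open>n\<close> generators whose indices add up to \<open>j\<close> is \<open>na + jd\<close>, and \<open>n\<close> indices between \<open>0\<close> and
\<open>k\<close> can have any sum up to \<open>kn\<close>.\<close>

lemma semigroup_gen_arith_gens:
  assumes "lin_indep_rat a d"
  shows "semigroup_gen (arith_gens a d k) = {nat_comb a d n j | n j. j \<le> k * n}"
proof (intro equalityI subsetI)
  have gen: "a + nscale i d = nat_comb a d 1 i" for i by (simp add: nat_comb_def)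
  have gens: "arith_gens a d k = nat_comb a d 1 ` {0..k}" by (simp add: arith_gens_def gen)
  {
    have inj: "inj_on (nat_comb a d 1) {0..k}" using nat_comb_inj[OF assms] by (auto intro: inj_onI)
    fix s assume "s \<in> semigroup_gen (arith_gens a d k)"
    then obtain l where "s = (\<Sum>x\<in>arith_gens a d k. nscale (l x) x)" by (auto simp: semigroup_gen_def)
    then have "s = (\<Sum>i\<in>{0..k}. nat_comb a d (l (nat_comb a d 1 i)) (l (nat_comb a d 1 i) * i))"
      by (simp only: gens sum.reindex[OF inj] o_def nscale_nat_comb mult_1_right)
    then have "s = nat_comb a d (\<Sum>i\<in>{0..k}. l (nat_comb a d 1 i)) (\<Sum>i\<in>{0..k}. l (nat_comb a d 1 i) * i)"
      by (simp only: nat_comb_sum)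
    moreover have "(\<Sum>i\<in>{0..k}. l (nat_comb a d 1 i) * i) \<le> k * (\<Sum>i\<in>{0..k}. l (nat_comb a d 1 i))"
      by (auto simp: sum_distrib_left mult.commute intro!: sum_mono)
    ultimately show "s \<in> {nat_comb a d n j | n j. j \<le> k * n}" by blast
  next
    interpret cring "semigroup_ring TYPE(rat) (semigroup_gen (arith_gens a d k))"
      by (rule semigroup_ring_cring)
    interpret semigroup_algebra "TYPE(rat)" "semigroup_gen (arith_gens a d k)" ..
    have mem: "nat_comb a d n j \<in> semigroup_gen (arith_gens a d k)" if "j \<le> k * n" for n j
      using that
    proof (induction n arbitrary: j)
      case 0
      then show ?case using zero_mem by simp
    next
      case (Suc n)
      define i where "i = min j k"
      have "nat_comb a d 1 i \<in> semigroup_gen (arith_gens a d k)"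
        by (intro semigroup_gen_generator) (auto simp: gens i_def)
      moreover have "nat_comb a d n (j - i) \<in> semigroup_gen (arith_gens a d k)"
        using Suc.prems by (intro Suc.IH) (auto simp: i_def min_def)
      ultimately have "nat_comb a d 1 i + nat_comb a d n (j - i) \<in> semigroup_gen (arith_gens a d k)"
        by (rule add_mem)
      then show ?case by (simp add: nat_comb_add i_def)
    qed
    fix s assume "s \<in> {nat_comb a d n j | n j. j \<le> k * n}"
    then show "s \<in> semigroup_gen (arith_gens a d k)" using mem by blast
  }
qed

text \<open>The pairs \<open>(j, kn - j)\<close> are the exponents in the Veronese picture. If such a pair dominates
another one componentwise, the difference satisfies \<open>j - j' \<le> k (n - n')\<close> and so belongs to \<open>S\<close>.\<close>

lemma finite_basis_cone:
  fixes a d :: "nat \<times> nat"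
  assumes "k > 0" and S: "S = {nat_comb a d n j | n j. j \<le> k * n}" and L: "L \<subseteq> S"
  shows "\<exists>F\<subseteq>L. finite F \<and> (\<forall>l\<in>L. \<exists>f\<in>F. \<exists>s\<in>S. l = s + f)"
proof -
  let ?L = "{(j, k * n - j) | n j. j \<le> k * n \<and> nat_comb a d n j \<in> L}"
  obtain F where F: "F \<subseteq> ?L" "finite F" "\<forall>(x, y)\<in>?L. \<exists>(x', y')\<in>F. x' \<le> x \<and> y' \<le> y"
    using dickson_nat_pairs[of ?L] by (elim exE conjE)
  let ?c = "\<lambda>(x, y). nat_comb a d ((x + y) div k) x"
  have c: "?c (j, k * n - j) = nat_comb a d n j" if "j \<le> k * n" for n j
    using that \<open>k > 0\<close> by simp
  show ?thesis
  proof (intro exI[of _ "?c ` F"] conjI ballI)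
    show "?c ` F \<subseteq> L" using F(1) c by fastforce
    show "finite (?c ` F)" using F(2) by simp
    fix l assume l: "l \<in> L"
    then obtain n j where nj: "l = nat_comb a d n j" "j \<le> k * n" using L S by auto
    then have "(j, k * n - j) \<in> ?L" using l by auto
    from bspec[OF F(3) this] obtain x y where xy: "(x, y) \<in> F" "x \<le> j" "y \<le> k * n - j"
      by auto
    then obtain n' j' where n': "x = j'" "y = k * n' - j'" "j' \<le> k * n'" using F(1) by auto
    have "k * n' \<le> k * n" using xy n' nj by linarith
    then have "n' \<le> n" using \<open>k > 0\<close> by simp
    then have "l = nat_comb a d (n - n') (j - j') + nat_comb a d n' j'"
      using xy n' nj by (simp add: nat_comb_add)
    moreover have "j - j' \<le> k * (n - n')" using xy n' nj by (simp add: diff_mult_distrib2)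
    moreover have "?c (x, y) = nat_comb a d n' j'" unfolding n'(1,2) by (rule c[OF n'(3)])
    ultimately show "\<exists>f\<in>?c ` F. \<exists>s\<in>S. l = s + f"
      using xy(1) unfolding S by (intro bexI[of _ "nat_comb a d n' j'"] bexI[of _ "nat_comb a d (n - n') (j - j')"]) force+
  qed
qed

theorem theorem3p4:
  fixes a d :: "nat \<times> nat" and k :: nat
  assumes "k \<ge> 2"
    and "lin_indep_rat a d"
    and "minimal_generating_set (arith_gens a d k) (semigroup_gen (arith_gens a d k))"
  shows "cohen_macaulay (semigroup_ring TYPE('k::field) (semigroup_gen (arith_gens a d k)))"
proof -
  let ?S = "semigroup_gen (arith_gens a d k)"
  interpret cring "semigroup_ring TYPE('k) ?S" by (rule semigroup_ring_cring)
  interpret semigroup_algebra "TYPE('k)" ?S ..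
  have k: "k > 0" using assms(1) by simp
  note S = semigroup_gen_arith_gens[OF assms(2), of k]
  have mem: "nat_comb a d n j \<in> ?S" if "j \<le> k * n" for n j using that S by auto
  let ?c = "nat_comb a d"
  show ?thesis
  proof (rule cohen_macaulayI[where n = 2])
    show "cring R" by (rule is_cring)
    show "noetherian_ring R"
      by (rule noetherian_if_finite_bases) (rule finite_basis_cone[OF k S])
    show "l \<le> 2" if "prime_chain R l P" for l P
      using that by (rule prime_chain_length_le_2)
    fix m assume m: "maximalideal m R"
    interpret m: maximalideal m R by fact
    \<comment> \<open>\<open>w = t\<^bsup>a+d\<^esup> / t\<^sup>a\<close>, so that \<open>t\<^bsup>na+jd\<^esup> = (t\<^sup>a)\<^sup>n w\<^sup>j\<close>\<close>
    have "\<exists>p. p \<noteq> 0 \<and> eval_at_monomial (?c 1 0) p \<in> m"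
    proof (rule maximal_ideal_contains_poly_in_monomial[OF m mem mem])
      fix s assume "s \<in> ?S"
      then obtain n j where "s = ?c n j" using S by auto
      then show "\<exists>n j. s + nscale j (?c 1 0) = nscale n (?c 1 0) + nscale j (?c 1 1)"
        by (intro exI[of _ n] exI[of _ j]) (simp add: nscale_nat_comb nat_comb_add)
    qed (use k in auto)
    then obtain p where p: "p \<noteq> 0" "eval_at_monomial (?c 1 0) p \<in> m" by blast
    \<comment> \<open>the same from the other end of the sequence, with \<open>w = t\<^bsup>a+(k-1)d\<^esup> / t\<^bsup>a+kd\<^esup>\<close>\<close>
    have "\<exists>q. q \<noteq> 0 \<and> eval_at_monomial (?c 1 k) q \<in> m"
    proof (rule maximal_ideal_contains_poly_in_monomial[OF m mem mem])
      fix s assume "s \<in> ?S"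
      then obtain n i where s: "s = ?c n i" "i \<le> k * n" using S by auto
      define j where "j = k * n - i"
      have "i + j = n * k" using s(2) by (simp add: j_def mult.commute)
      moreover have "j * k = j + j * (k - 1)" using k by (cases k) simp_all
      ultimately have "i + j * k = n * k + j * (k - 1)" by linarith
      then show "\<exists>n j. s + nscale j (?c 1 k) = nscale n (?c 1 k) + nscale j (?c 1 (k - 1))"
        by (intro exI[of _ n] exI[of _ j]) (simp add: nscale_nat_comb nat_comb_add s)
    qed simp_all
    then obtain q where q: "q \<noteq> 0" "eval_at_monomial (?c 1 k) q \<in> m" by blast
    \<comment> \<open>\<open>n = \<lceil>j/k\<rceil>\<close> is the least \<open>n\<close> with \<open>na + jd \<in> S\<close>: the monomials not divisible by \<open>t\<^sup>a\<close>\<close>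
    define b where "b j = ?c ((j + (k - 1)) div k) j" for j
    have b: "nscale n (?c 1 0) + b j = ?c (n + (j + (k - 1)) div k) j" for n j
      by (simp add: b_def nscale_nat_comb nat_comb_add)
    have bk: "j \<le> k * ((j + (k - 1)) div k)" for j
      using k mult_div_mod_eq[of k "j + (k - 1)"] mod_less_divisor[OF k, of "j + (k - 1)"]
      by linarith
    have "regular_sequence R [eval_at_monomial (?c 1 0) p, eval_at_monomial (?c 1 k) q]"
    proof (rule regular_sequence_if_free[where b = b and k = k and I = m])
      show "?c 1 0 \<in> ?S" "?c 1 k \<in> ?S" by (intro mem; simp)+
      show "b j \<in> ?S" for j unfolding b_def by (intro mem bk)
      show "n = n' \<and> j = j'" if "nscale n (?c 1 0) + b j = nscale n' (?c 1 0) + b j'" for n j n' j'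
        using nat_comb_inj[OF assms(2) that[unfolded b]] by auto
      show "\<exists>n j. s = nscale n (?c 1 0) + b j" if "s \<in> ?S" for s
      proof -
        obtain n j where s: "s = ?c n j" "j \<le> k * n" using \<open>s \<in> ?S\<close> S by auto
        have "(j + (k - 1)) div k < Suc n"
          using s(2) k by (intro less_mult_imp_div_less) (simp add: algebra_simps)
        then have "s = nscale (n - (j + (k - 1)) div k) (?c 1 0) + b j"
          unfolding b s(1) by (simp del: One_nat_def)
        then show ?thesis by blast
      qed
      show "b (j + k) = b j + ?c 1 k" for j
      proof -
        have "(j + k + (k - 1)) div k = (j + (k - 1)) div k + 1"
          using k div_add_self2[of k "j + (k - 1)"] by (simp add: ac_simps)
        then show ?thesis by (simp add: b_def nat_comb_add)
      qed
    qed (use p q k m.is_ideal m.I_notcarr in auto)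
    then show "\<exists>xs. regular_sequence R xs \<and> set xs \<subseteq> m \<and> length xs = 2"
      using p q by (intro exI[of _ "[eval_at_monomial (?c 1 0) p, eval_at_monomial (?c 1 k) q]"]) auto
  qed
qed

end
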